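(* There is an absolute constant $C>0$ such that the following holds. Let $m>1$ be an integer, $0<\varepsilon<1$, and let $f\in\mathbb{Z}_m[x_1,\ldots,x_n]$ be a polynomial of degree at most $2$. If there exists a prime power $q$ with $q\,\|\,m$ such that $f$ modulo $q$ has boolean rank at least $C m^2\log(1/\varepsilon)$, then \[ \Big|\,\mathbb{E}_{\mathbf x\in B^n} e_m(f(\mathbf x))\Big|<\varepsilon. \]
   Context: $B=\{0,1\}$, and $\mathbb{E}_{\mathbf x\in B^n}$ denotes the average over $\mathbf x$ uniform in $B^n$. $e_m(j)=e^{2\pi i j/m}$, well defined on $\mathbb{Z}_m$. For a prime power $q=p^a$, $q\,\|\,m$ means $p^a\mid m$ but $p^{a+1}\nmid m$. The boolean rank of $f$ modulo $q$ is the minimal $r$ such that there exist a function $F:\mathbb{Z}_q^r\to\mathbb{Z}_q$ and vectors $\mathbf v_1,\ldots,\mathbf v_r\in\mathbb{Z}_q^n$ with $f(\mathbf x)\equiv F(\mathbf v_1^T\mathbf x,\ldots,\mathbf v_r^T\mathbf x)\pmod q$ for all $\mathbf x\in B^n$. *)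

theory Defs
  imports
    Complex_Main
    "HOL-Library.FuncSet"
    "HOL-Library.Poly_Mapping"
    "HOL-Computational_Algebra.Primes"
begin

text \<open>
  The ring \<open>\<int>\<^sub>m\<close> is represented by the canonical residues \<open>{0..<m}\<close>.
  Values of polynomials are left as integers and are only used modulo \<open>m\<close>
  (or modulo a divisor of \<open>m\<close>).
\<close>

definition Zmod :: "nat \<Rightarrow> int set" where
  "Zmod m = {0..<int m}"

text \<open>
  A polynomial is a finitely supported map from monomials to coefficients, a monomial being
  a finitely supported map from variable indices to exponents. The variables
  \<open>x\<^sub>1, \<dots>, x\<^sub>n\<close> are indexed by \<open>0, \<dots>, n - 1\<close>.
\<close>

type_synonym monomial = "nat \<Rightarrow>\<^sub>0 nat"
type_synonym polynomial = "monomial \<Rightarrow>\<^sub>0 int"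

definition poly_ring_Zmod :: "nat \<Rightarrow> nat \<Rightarrow> polynomial set" where
  "poly_ring_Zmod m n =
     {f. (\<forall>t. Poly_Mapping.lookup f t \<in> Zmod m) \<and>
         (\<forall>t \<in> Poly_Mapping.keys f. Poly_Mapping.keys t \<subseteq> {..<n})}"

definition monomial_degree :: "monomial \<Rightarrow> nat" where
  "monomial_degree t = (\<Sum>i \<in> Poly_Mapping.keys t. Poly_Mapping.lookup t i)"

definition degree_le :: "polynomial \<Rightarrow> nat \<Rightarrow> bool" where
  "degree_le f d \<longleftrightarrow> (\<forall>t \<in> Poly_Mapping.keys f. monomial_degree t \<le> d)"

definition poly_eval :: "polynomial \<Rightarrow> (nat \<Rightarrow> int) \<Rightarrow> int" where
  "poly_eval f x =
     (\<Sum>t \<in> Poly_Mapping.keys f.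
        Poly_Mapping.lookup f t * (\<Prod>i \<in> Poly_Mapping.keys t. x i ^ Poly_Mapping.lookup t i))"

definition boolean_cube :: "nat \<Rightarrow> (nat \<Rightarrow> int) set" where
  "boolean_cube n = {..<n} \<rightarrow>\<^sub>E {0, 1}"

definition cube_average :: "nat \<Rightarrow> ((nat \<Rightarrow> int) \<Rightarrow> complex) \<Rightarrow> complex" where
  "cube_average n g = (\<Sum>x \<in> boolean_cube n. g x) / of_nat (card (boolean_cube n))"

definition e_char :: "nat \<Rightarrow> int \<Rightarrow> complex" where
  "e_char m j = exp (2 * of_real pi * \<i> * of_int j / of_nat m)"

definition exact_prime_power_divisor :: "nat \<Rightarrow> nat \<Rightarrow> bool" where
  "exact_prime_power_divisor q m \<longleftrightarrow>
     (\<exists>p a. prime p \<and> a \<ge> 1 \<and> q = p ^ a \<and> p ^ a dvd m \<and> \<not> p ^ (a + 1) dvd m)"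

definition boolean_representable :: "nat \<Rightarrow> nat \<Rightarrow> ((nat \<Rightarrow> int) \<Rightarrow> int) \<Rightarrow> nat \<Rightarrow> bool" where
  "boolean_representable q n f r \<longleftrightarrow>
     (\<exists>F \<in> ({..<r} \<rightarrow>\<^sub>E Zmod q) \<rightarrow> Zmod q.
      \<exists>v \<in> {..<r} \<rightarrow> ({..<n} \<rightarrow>\<^sub>E Zmod q).
      \<forall>x \<in> boolean_cube n.
        f x mod int q = F (\<lambda>j \<in> {..<r}. (\<Sum>i<n. v j i * x i) mod int q))"

definition boolean_rank :: "nat \<Rightarrow> nat \<Rightarrow> ((nat \<Rightarrow> int) \<Rightarrow> int) \<Rightarrow> nat" where
  "boolean_rank q n f = (LEAST r. boolean_representable q n f r)"

text \<open>The minimum is over a nonempty set: the \<open>n\<close> unit vectors always suffice.\<close>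

lemma boolean_representable_dim:
  assumes q: "q > 1"
  shows "boolean_representable q n f n"
  unfolding boolean_representable_def
proof (intro bexI ballI)
  let ?F = "\<lambda>y. f y mod int q"
  let ?v = "\<lambda>j. \<lambda>i \<in> {..<n}. of_bool (i = j) :: int"
  show "?F \<in> ({..<n} \<rightarrow>\<^sub>E Zmod q) \<rightarrow> Zmod q"
    using q by (auto simp: Zmod_def)
  show "?v \<in> {..<n} \<rightarrow> ({..<n} \<rightarrow>\<^sub>E Zmod q)"
    using q by (auto simp: Zmod_def)
  fix x assume x: "x \<in> boolean_cube n"
  have "(\<lambda>j \<in> {..<n}. (\<Sum>i<n. ?v j i * x i) mod int q) = x"
  proof
    fix j
    show "(\<lambda>j \<in> {..<n}. (\<Sum>i<n. ?v j i * x i) mod int q) j = x j"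
    proof (cases "j < n")
      case True
      have "(\<Sum>i<n. ?v j i * x i) = (\<Sum>i<n. if i = j then x i else 0)"
        by (rule sum.cong) auto
      also have "\<dots> = x j" using True by simp
      finally have s: "(\<Sum>i<n. ?v j i * x i) = x j" .
      have "x j \<in> {0, 1}" using x True by (auto simp: boolean_cube_def PiE_def Pi_def)
      then have "x j mod int q = x j" using q by auto
      then show ?thesis using True s by simp
    next
      case False
      then show ?thesis using x by (auto simp: boolean_cube_def PiE_def extensional_def)
    qed
  qed
  then show "f x mod int q = ?F (\<lambda>j \<in> {..<n}. (\<Sum>i<n. ?v j i * x i) mod int q)" by simp
qed

end

theory Submission imports Defs "HOL-Analysis.Analysis" begin

text \<open>
  On the cube, \<open>f\<close> is a quadratic function with a symmetric matrix \<open>M\<close> whose diagonal is irrelevant.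
  Elimination modulo \<open>q\<close> that avoids the diagonal produces disjoint index sets \<open>A\<close>, \<open>B\<close> of
  size \<open>k\<close> such that the rows \<open>A\<close> are independent on the columns \<open>B\<close>, while off the diagonal all
  other entries come from the rows \<open>A\<close>. Cauchy-Schwarz applied to the bilinear part between \<open>A\<close> and its
  complement bounds the squared bias by \<open>(1 - \<Omega>(m\<^sup>-\<^sup>2))\<^sup>k\<close>. If \<open>q\<close> is odd, fixing \<open>O(k)\<close> linear forms
  makes \<open>f\<close> linear, so the rank is \<open>O(k + 1)\<close>. If \<open>q\<close> is even, the diagonal matters
  (\<open>\<Sum>\<^bsub>i<j\<^esub> x\<^sub>i x\<^sub>j\<close> modulo 2 has \<open>k = 1\<close> and large rank), and one also uses a maximal set \<open>I\<close> of rows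
  independent modulo 2: averaging the derivatives \<open>f(x \<oplus> h) - f(x)\<close> bounds the squared bias by
  \<open>(1 - \<Omega>(m\<^sup>-\<^sup>2))\<^sup>|\<^sup>I\<^sup>|\<close>, and once the forms belonging to \<open>A\<close>, \<open>B\<close>, \<open>I\<close> are fixed the remaining
  quadratic term is an additive function on a subgroup, hence extends to a linear form modulo \<open>q\<close>.
\<close>

section \<open>Independence modulo a prime power\<close>

text \<open>With \<open>q = p\<^sup>a\<close>: relations are tested modulo \<open>q\<close> but need only be trivial modulo \<open>p\<close>, so that
  \<open>p\<^bsup>a-1\<^esup>\<close> times an identity matrix counts as independent.\<close>

definition indep_mod :: "int \<Rightarrow> int \<Rightarrow> 'a set \<Rightarrow> 'b set \<Rightarrow> ('a \<Rightarrow> 'b \<Rightarrow> int) \<Rightarrow> bool" where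
  "indep_mod p q A B r \<longleftrightarrow>
     (\<forall>c. (\<forall>j\<in>B. q dvd (\<Sum>i\<in>A. c i * r i j)) \<longrightarrow> (\<forall>i\<in>A. p dvd c i))"

lemma gcd_dvd_imp_multiple_mod:
  fixes s t q :: int
  assumes "gcd t q dvd s"
  shows "\<exists>l. q dvd s - l * t"
proof -
  obtain k where k: "s = gcd t q * k" using assms by (auto elim: dvdE)
  obtain u v where "u * t + v * q = gcd t q" using bezout_int by blast
  then have "s - (u * k) * t = q * (v * k)" unfolding k by (metis add_diff_cancel_left' distrib_right mult.assoc mult.commute)
  then show ?thesis by (metis dvd_triv_left)
qed

text \<open>Such divisors are powers of \<open>p\<close>, so divisibility orders them totally, and a
  failure of \<open>x dvd y\<close> leaves room for one more factor \<open>p\<close>.\<close>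

lemma prime_power_dvd_linear:
  fixes p x y :: int
  assumes "prime p" "x dvd p ^ a" "y dvd p ^ a" "x \<ge> 0" "y \<ge> 0"
  shows "x dvd y \<or> p * y dvd x"
proof -
  obtain i where i: "x = p ^ i"
    using divides_primepow[OF assms(1,2)] assms(4) by (auto simp: normalize_int_def)
  obtain j where j: "y = p ^ j"
    using divides_primepow[OF assms(1,3)] assms(5) by auto
  show ?thesis
  proof (cases "i \<le> j")
    case True then show ?thesis by (simp add: i j le_imp_power_dvd)
  next
    case False
    then have "p ^ Suc j dvd p ^ i" by (intro le_imp_power_dvd) auto
    then show ?thesis by (simp add: i j)
  qed
qed

text \<open>Of two elements modulo \<open>p ^ a\<close>, one is a multiple of the other. The
  asymmetry matters: if \<open>s\<close> is no multiple of \<open>t\<close>, the multiplier taking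
  \<open>s\<close> to \<open>t\<close> can be chosen divisible by \<open>p\<close>, which later
  makes coefficients vanish modulo \<open>p\<close>.\<close>

lemma prime_power_multiple_mod_cases:
  fixes p s t :: int
  assumes "prime p"
  obtains l where "p ^ a dvd s - l * t" | l where "p ^ a dvd t - p * l * s"
proof -
  consider "gcd t (p^a) dvd gcd s (p^a)" | "p * gcd s (p^a) dvd gcd t (p^a)"
    using prime_power_dvd_linear[OF assms, of "gcd t (p^a)" a "gcd s (p^a)"] by auto
  then show thesis
  proof cases
    case 1
    then have "gcd t (p^a) dvd s" by simp
    from gcd_dvd_imp_multiple_mod[OF this] show thesis using that(1) by blast
  next
    case 2
    then have "p * gcd s (p^a) dvd t" by simp
    then obtain t' where t: "t = p * t'" "gcd s (p^a) dvd t'"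
      by (metis dvd_def mult.assoc dvd_triv_left)
    obtain l where "p ^ a dvd t' - l * s" using gcd_dvd_imp_multiple_mod[OF t(2)] by blast
    then have "p ^ a dvd p * (t' - l * s)" by (rule dvd_mult)
    then show thesis using that(2)[of l] by (simp add: t algebra_simps)
  qed
qed

lemma indep_mod_subset:
  assumes "indep_mod p q A B r" "T \<subseteq> A" "finite A"
  shows "indep_mod p q T B r"
  unfolding indep_mod_def
proof (intro allI impI)
  fix c assume c: "\<forall>j\<in>B. q dvd (\<Sum>i\<in>T. c i * r i j)"
  define c' where "c' i = (if i \<in> T then c i else 0)" for i
  have "(\<Sum>i\<in>A. c' i * r i j) = (\<Sum>i\<in>T. c i * r i j)" for j
    using assms(2,3) by (intro sum.mono_neutral_cong_right) (auto simp: c'_def)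
  then have "\<forall>i\<in>A. p dvd c' i" using assms(1) c unfolding indep_mod_def by metis
  then have "p dvd c' i" if "i \<in> T" for i using that assms(2) by blast
  then show "\<forall>i\<in>T. p dvd c i" by (metis c'_def)
qed

lemma indep_mod_mono:
  assumes "indep_mod p q A B r" "B \<subseteq> D"
  shows "indep_mod p q A D r"
  using assms unfolding indep_mod_def by (meson subsetD)

text \<open>Dropping a column costs at most one row. The relation \<open>c\<close> and any relation
  \<open>d\<close> on the other rows both vanish on \<open>B\<close>; a combination of them that
  also kills column \<open>j\<close> must be trivial modulo \<open>p\<close>.\<close>

lemma indep_mod_delete:
  fixes p q :: int
  assumes p: "prime p" and q: "q = p ^ a" and A: "finite A" "i0 \<in> A"
    and ind: "indep_mod p q A (insert j B) r"
    and c: "\<forall>k\<in>B. q dvd (\<Sum>i\<in>A. c i * r i k)" "\<not> p dvd c i0"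
  shows "indep_mod p q (A - {i0}) B r"
  unfolding indep_mod_def
proof (intro allI impI ballI)
  fix d i assume d: "\<forall>k\<in>B. q dvd (\<Sum>i\<in>A-{i0}. d i * r i k)" and i: "i \<in> A - {i0}"
  define d' where "d' i = (if i = i0 then 0 else d i)" for i
  have d'sum: "(\<Sum>i\<in>A. d' i * r i k) = (\<Sum>i\<in>A-{i0}. d i * r i k)" for k
    using A by (intro sum.mono_neutral_cong_right) (auto simp: d'_def)
  define s where "s = (\<Sum>i\<in>A. c i * r i j)"
  define t where "t = (\<Sum>i\<in>A. d' i * r i j)"
  have comb: "\<forall>i\<in>A. p dvd x * c i - y * d' i" if "q dvd x * s - y * t" for x y
  proof -
    have "q dvd (\<Sum>i\<in>A. (x * c i - y * d' i) * r i k)" if "k \<in> insert j B" for k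
    proof -
      have eq: "(\<Sum>i\<in>A. (x * c i - y * d' i) * r i k)
         = x * (\<Sum>i\<in>A. c i * r i k) - y * (\<Sum>i\<in>A. d' i * r i k)"
        by (simp add: sum_distrib_left sum_subtractf algebra_simps)
      show ?thesis
      proof (cases "k = j")
        case True then show ?thesis using \<open>q dvd x * s - y * t\<close> eq by (simp add: s_def t_def)
      next
        case False
        then have "k \<in> B" using that by simp
        then show ?thesis unfolding eq d'sum using c(1) d by (intro dvd_diff dvd_mult) auto
      qed
    qed
    then show ?thesis
      using ind[unfolded indep_mod_def, rule_format, of "\<lambda>i. x * c i - y * d' i"] by blast
  qed
  \<comment> \<open>Cancelling \<open>s\<close> by a multiple of \<open>t\<close> would force
    \<open>p dvd c i0\<close>, since \<open>d'\<close> vanishes at \<open>i0\<close>. Hence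
    \<open>t\<close> is cancelled by a multiple of \<open>p * s\<close>, and the factor
    \<open>p\<close> passes to \<open>d\<close>.\<close>
  consider l where "q dvd s - l * t" | l where "q dvd t - p * l * s"
    using prime_power_multiple_mod_cases[OF p, of a s t] q by metis
  then show "p dvd d i"
  proof cases
    case 1
    then have "\<forall>i\<in>A. p dvd 1 * c i - l * d' i" by (intro comb) simp
    then have "p dvd c i0" using A(2) by (auto simp: d'_def)
    then show ?thesis using c(2) by simp
  next
    case 2
    then have "q dvd (p * l) * s - 1 * t" by (metis dvd_minus_iff minus_diff_eq mult_1)
    from comb[OF this] i have "p dvd p * l * c i - d i" by (auto simp: d'_def)
    then show ?thesis by (metis dvd_diff_right_iff dvd_triv_left mult.assoc)
  qed
qed

section \<open>Counting subsets with prescribed row sums modulo \<open>q\<close>\<close>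

lemma card_Pow_insert_split:
  assumes "finite B" "j \<notin> B"
  shows "card {Z \<in> Pow (insert j B). P Z}
       = card {Z \<in> Pow B. P Z} + card {Z \<in> Pow B. P (insert j Z)}"
proof -
  have "{Z \<in> Pow (insert j B). P Z} = {Z \<in> Pow B. P Z} \<union> insert j ` {Z \<in> Pow B. P (insert j Z)}"
    by (auto simp: Pow_insert)
  moreover have "{Z \<in> Pow B. P Z} \<inter> insert j ` {Z \<in> Pow B. P (insert j Z)} = {}"
    using assms(2) by auto
  moreover have "card (insert j ` {Z \<in> Pow B. P (insert j Z)}) = card {Z \<in> Pow B. P (insert j Z)}"
    using assms(2) by (intro card_image inj_onI) (auto simp: subset_iff)
  ultimately show ?thesis using assms(1) by (simp add: card_Un_disjoint)
qed

text \<open>Each row halves the number of solutions, as over a field. Split by whether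
  \<open>j\<close> is in the solution: if the rows stay independent on \<open>B\<close>, the bound
  holds for both halves; otherwise a relation on \<open>B\<close> empties one half, and the other
  pays for the row removed by \<open>indep_mod_delete\<close>.\<close>

lemma indep_mod_card_solutions:
  fixes p q :: int and c :: "'a \<Rightarrow> int"
  assumes p: "prime p" and q: "q = p ^ a" and "finite B" "finite A"
    and "indep_mod p q A B r"
  shows "card {Z \<in> Pow B. \<forall>i\<in>A. q dvd (\<Sum>j\<in>Z. r i j) - c i} * 2 ^ card A \<le> 2 ^ card B"
  using assms(3-5)
proof (induction B arbitrary: A c rule: finite_induct)
  case empty
  have "A = {}"
  proof (rule ccontr)
    assume "A \<noteq> {}"
    moreover have "\<forall>i\<in>A. p dvd 1"
      using empty(2)[unfolded indep_mod_def, rule_format, of "\<lambda>_. 1"] by blast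
    ultimately show False using p by auto
  qed
  then show ?case by (simp add: Pow_def)
next
  case (insert j B)
  let ?N = "\<lambda>A c. card {Z \<in> Pow B. \<forall>i\<in>A. q dvd (\<Sum>j\<in>Z. r i j) - c i}"
  have fin: "finite Z" if "Z \<in> Pow B" for Z using that insert(1) finite_subset by auto
  have sh: "{Z \<in> Pow B. \<forall>i\<in>A. q dvd (\<Sum>j\<in>insert j Z. r i j) - c i}
         = {Z \<in> Pow B. \<forall>i\<in>A. q dvd (\<Sum>j\<in>Z. r i j) - (c i - r i j)}"
  proof -
    have "(\<Sum>k\<in>insert j Z. r i k) - c i = (\<Sum>k\<in>Z. r i k) - (c i - r i j)" if "Z \<in> Pow B" for Z i
    proof -
      have "j \<notin> Z" using that insert(2) by auto
      then show ?thesis using fin[OF that] by simp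
    qed
    then show ?thesis by (auto simp: algebra_simps)
  qed
  have split: "card {Z \<in> Pow (insert j B). \<forall>i\<in>A. q dvd (\<Sum>j\<in>Z. r i j) - c i}
     = ?N A c + ?N A (\<lambda>i. c i - r i j)"
    using card_Pow_insert_split[OF insert(1,2), of "\<lambda>Z. \<forall>i\<in>A. q dvd (\<Sum>j\<in>Z. r i j) - c i"] sh by simp
  show ?case
  proof (cases "indep_mod p q A B r")
    case True
    from insert.IH[OF insert.prems(1) True, of c] insert.IH[OF insert.prems(1) True, of "\<lambda>i. c i - r i j"]
    show ?thesis unfolding split using insert(1,2) by (simp add: algebra_simps)
  next
    case False
    then obtain d i0 where d: "\<forall>k\<in>B. q dvd (\<Sum>i\<in>A. d i * r i k)" "i0 \<in> A" "\<not> p dvd d i0"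
      unfolding indep_mod_def by auto
    let ?A = "A - {i0}"
    have ind: "indep_mod p q ?A B r"
      by (rule indep_mod_delete[OF p q insert.prems(1) d(2) insert.prems(2) d(1) d(3)])
    have fA: "finite ?A" using insert.prems by simp
    have le: "?N A c' \<le> ?N ?A c'" for c'
      using insert(1) by (intro card_mono) auto
    have cA: "card A = Suc (card ?A)" using d(2) insert.prems(1) by (metis card.remove)
    have ns: "\<not> q dvd (\<Sum>i\<in>A. d i * r i j)"
      using insert.prems(2) d unfolding indep_mod_def by auto
    \<comment> \<open>The combination \<open>d\<close> of the equations reads off whether \<open>j\<close> belongs to the solution.\<close>
    have comb: "q dvd (\<Sum>i\<in>A. d i * c' i)" if "?N A c' \<noteq> 0" for c'
    proof -
      obtain Z where Z: "Z \<in> Pow B" "\<forall>i\<in>A. q dvd (\<Sum>j\<in>Z. r i j) - c' i"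
        using \<open>?N A c' \<noteq> 0\<close> by (metis (mono_tags, lifting) card.empty ex_in_conv mem_Collect_eq)
      have "q dvd (\<Sum>i\<in>A. d i * ((\<Sum>j\<in>Z. r i j) - c' i))"
        using Z(2) by (intro dvd_sum dvd_mult) auto
      also have "(\<Sum>i\<in>A. d i * ((\<Sum>j\<in>Z. r i j) - c' i))
         = (\<Sum>i\<in>A. \<Sum>k\<in>Z. d i * r i k) - (\<Sum>i\<in>A. d i * c' i)"
        by (simp add: right_diff_distrib sum_subtractf sum_distrib_left)
      also have "(\<Sum>i\<in>A. \<Sum>k\<in>Z. d i * r i k) = (\<Sum>k\<in>Z. \<Sum>i\<in>A. d i * r i k)"
        by (rule sum.swap)
      finally have 1: "q dvd (\<Sum>k\<in>Z. \<Sum>i\<in>A. d i * r i k) - (\<Sum>i\<in>A. d i * c' i)" .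
      have "q dvd (\<Sum>k\<in>Z. \<Sum>i\<in>A. d i * r i k)" using Z(1) d(1) by (intro dvd_sum[of Z]) blast
      then show ?thesis using 1 dvd_diff_right_iff by blast
    qed
    have "?N A c = 0 \<or> ?N A (\<lambda>i. c i - r i j) = 0"
    proof (rule ccontr)
      assume "\<not> ?thesis"
      then have "q dvd (\<Sum>i\<in>A. d i * c i)" "q dvd (\<Sum>i\<in>A. d i * (c i - r i j))"
        using comb[of c] comb[of "\<lambda>i. c i - r i j"] by blast+
      then have "q dvd (\<Sum>i\<in>A. d i * c i) - (\<Sum>i\<in>A. d i * (c i - r i j))" by (rule dvd_diff)
      then show False using ns by (simp add: right_diff_distrib sum_subtractf)
    qed
    moreover have bnd: "?N A c' * 2 ^ card ?A \<le> 2 ^ card B" for c'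
      using insert.IH[OF fA ind, of c'] mult_le_mono1[OF le] order_trans by blast
    ultimately have "(?N A c + ?N A (\<lambda>i. c i - r i j)) * 2 ^ card ?A \<le> 2 ^ card B"
      using bnd[of c] bnd[of "\<lambda>i. c i - r i j"] by (elim disjE) simp_all
    then show ?thesis unfolding split cA using insert(1,2) by simp
  qed
qed

text \<open>Expanding each factor as \<open>(1 - \<alpha>) * h + \<alpha>\<close> gives a sum over
  sets \<open>T\<close> of rows whose equations hold. Each \<open>T\<close> is bounded by counting
  solutions, and the same expansion read backwards restores a product: as an upper bound, the
  equations act like independent events of probability 1/2.\<close>

lemma indep_mod_weighted_sum:
  fixes p q :: int and c :: "'a \<Rightarrow> int" and \<alpha> :: real
  assumes p: "prime p" and q: "q = p ^ a" and B: "finite B" and A: "finite A"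
    and ind: "indep_mod p q A B r" and \<alpha>: "0 \<le> \<alpha>" "\<alpha> \<le> 1"
  shows "(\<Sum>Z\<in>Pow B. \<Prod>i\<in>A. if q dvd (\<Sum>j\<in>Z. r i j) - c i then 1 else \<alpha>)
           \<le> 2 ^ card B * ((1 + \<alpha>) / 2) ^ card A"
proof -
  let ?h = "\<lambda>Z i. of_bool (q dvd (\<Sum>j\<in>Z. r i j) - c i) :: real"
  have cnt: "(\<Sum>Z\<in>Pow B. \<Prod>i\<in>T. ?h Z i) \<le> 2 ^ card B / 2 ^ card T" if T: "T \<subseteq> A" for T
  proof -
    have fT: "finite T" using T A finite_subset by blast
    have "(\<Prod>i\<in>T. ?h Z i) = of_bool (\<forall>i\<in>T. q dvd (\<Sum>j\<in>Z. r i j) - c i)" for Z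
      using fT by (induction T) auto
    then have "(\<Sum>Z\<in>Pow B. \<Prod>i\<in>T. ?h Z i)
       = real (card {Z \<in> Pow B. \<forall>i\<in>T. q dvd (\<Sum>j\<in>Z. r i j) - c i})"
      using B by (simp add: of_bool_def sum.If_cases Int_def)
    moreover have "real (card {Z \<in> Pow B. \<forall>i\<in>T. q dvd (\<Sum>j\<in>Z. r i j) - c i} * 2 ^ card T) \<le> real (2 ^ card B)"
      using indep_mod_card_solutions[OF p q B fT indep_mod_subset[OF ind T A], of c]
      by (rule of_nat_mono)
    ultimately show ?thesis by (simp add: field_simps)
  qed
  have "(\<Sum>Z\<in>Pow B. \<Prod>i\<in>A. if q dvd (\<Sum>j\<in>Z. r i j) - c i then 1 else \<alpha>)
      = (\<Sum>Z\<in>Pow B. \<Prod>i\<in>A. (1 - \<alpha>) * ?h Z i + \<alpha>)"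
    by (intro sum.cong prod.cong) auto
  also have "\<dots> = (\<Sum>Z\<in>Pow B. \<Sum>T\<in>Pow A. (\<Prod>i\<in>T. (1 - \<alpha>) * ?h Z i) * \<alpha> ^ card (A - T))"
    using A by (simp add: prod_add)
  also have "\<dots> = (\<Sum>T\<in>Pow A. (1 - \<alpha>) ^ card T * \<alpha> ^ card (A - T) * (\<Sum>Z\<in>Pow B. \<Prod>i\<in>T. ?h Z i))"
    by (subst sum.swap) (simp add: prod.distrib sum_distrib_left mult_ac)
  also have "\<dots> \<le> (\<Sum>T\<in>Pow A. (1 - \<alpha>) ^ card T * \<alpha> ^ card (A - T) * (2 ^ card B / 2 ^ card T))"
    using cnt \<alpha> by (intro sum_mono mult_left_mono) auto
  also have "\<dots> = 2 ^ card B * (\<Sum>T\<in>Pow A. (\<Prod>i\<in>T. (1 - \<alpha>) / 2) * (\<Prod>i\<in>A-T. \<alpha>))"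
    by (simp add: sum_distrib_left power_divide mult_ac)
  also have "(\<Sum>T\<in>Pow A. (\<Prod>i\<in>T. (1 - \<alpha>) / 2) * (\<Prod>i\<in>A-T. \<alpha>)) = (\<Prod>i\<in>A. (1 - \<alpha>) / 2 + \<alpha>)"
    using A by (simp only: prod_add)
  also have "\<dots> = ((1 + \<alpha>) / 2) ^ card A" by (simp add: field_simps)
  finally show ?thesis .
qed

section \<open>Elimination off the diagonal\<close>

text \<open>The pivot is an off-diagonal entry with least gcd with \<open>q\<close>, that is, of
  least \<open>p\<close>-adic valuation. Divisors of \<open>q\<close> form a chain, so this gcd
  divides all the others.\<close>

lemma pivot_entry_exists:
  fixes p q :: int and M :: "'a \<Rightarrow> 'a \<Rightarrow> int"
  assumes p: "prime p" and q: "q = p ^ a" and V: "finite V"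
    and ex: "\<exists>u\<in>V. \<exists>v\<in>V. u \<noteq> v \<and> \<not> q dvd M u v"
  obtains u v where "u \<in> V" "v \<in> V" "u \<noteq> v" "\<not> q dvd M u v"
    "\<And>s t. s \<in> V \<Longrightarrow> t \<in> V \<Longrightarrow> s \<noteq> t \<Longrightarrow> \<exists>l. q dvd M s t - l * M u v"
proof -
  have qpos: "q > 0" using p q by (simp add: prime_gt_0_int)
  let ?g = "\<lambda>(u, v). gcd (M u v) q"
  let ?S = "{(u, v). u \<in> V \<and> v \<in> V \<and> u \<noteq> v}"
  have "?S \<subseteq> V \<times> V" by auto
  then have S: "finite ?S" using V finite_subset by blast
  have "?S \<noteq> {}" using ex by auto
  then obtain w where w: "w \<in> ?S" "\<And>y. y \<in> ?S \<Longrightarrow> ?g w \<le> ?g y"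
    using arg_min_if_finite[OF S, of ?g] by (metis (no_types, lifting) not_le)
  obtain u v where uv: "w = (u, v)" by force
  have le: "gcd (M u v) q \<le> gcd (M s t) q" if "s \<in> V" "t \<in> V" "s \<noteq> t" for s t
    using w(2)[of "(s, t)"] that by (auto simp: uv)
  have l: "\<exists>l. q dvd M s t - l * M u v" if st: "s \<in> V" "t \<in> V" "s \<noteq> t" for s t
  proof -
    have pos: "gcd (M s t) q > 0" "gcd (M u v) q > 0" using qpos by auto
    consider "gcd (M u v) q dvd gcd (M s t) q" | "p * gcd (M s t) q dvd gcd (M u v) q"
      using prime_power_dvd_linear[OF p, of "gcd (M u v) q" a "gcd (M s t) q"] q by auto
    then have "gcd (M u v) q dvd gcd (M s t) q"
    proof cases
      case 2
      then have "p * gcd (M s t) q \<le> gcd (M u v) q" using pos zdvd_imp_le by blast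
      also have "\<dots> \<le> gcd (M s t) q" by (rule le[OF st])
      finally have "p \<le> 1" using pos by simp
      then show ?thesis using prime_gt_1_int[OF p] by simp
    qed
    then show ?thesis by (intro gcd_dvd_imp_multiple_mod) simp
  qed
  have nd: "\<not> q dvd M u v"
  proof
    assume d: "q dvd M u v"
    obtain s t where st: "s \<in> V" "t \<in> V" "s \<noteq> t" "\<not> q dvd M s t" using ex by blast
    obtain k where "q dvd M s t - k * M u v" using l[OF st(1-3)] by blast
    then have "q dvd M s t" using d by (metis dvd_diff_left_iff dvd_mult)
    then show False using st by simp
  qed
  have uvV: "u \<in> V" "v \<in> V" "u \<noteq> v" using w(1) by (auto simp: uv)
  show thesis by (rule that[OF uvV nd l])
qed

text \<open>Gaussian elimination that never touches the diagonal: a pivot \<open>(u, v)\<close> with \<open>u \<noteq> v\<close>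
  removes both indices, and eliminating its column changes the other off-diagonal entries only by
  multiples of off-diagonal entries.\<close>

lemma off_diagonal_elimination:
  fixes p q :: int and M :: "'a \<Rightarrow> 'a \<Rightarrow> int"
  assumes p: "prime p" and q: "q = p ^ a" and "finite V"
  shows "\<exists>A B L. A \<subseteq> V \<and> B \<subseteq> V \<and> A \<inter> B = {} \<and> card B = card A \<and> indep_mod p q A B M \<and>
     (\<forall>u\<in>V - A - B. \<forall>v\<in>V - A - B. u \<noteq> v \<longrightarrow> q dvd M u v - (\<Sum>a\<in>A. L u a * M a v))"
  using assms(3)
proof (induction "card V" arbitrary: V M rule: less_induct)
  case less
  show ?case
  proof (cases "\<exists>u\<in>V. \<exists>v\<in>V. u \<noteq> v \<and> \<not> q dvd M u v")
    case False
    then show ?thesis by (intro exI[of _ "{}"]) (auto simp: indep_mod_def)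
  next
    case True
    obtain u v where uv: "u \<in> V" "v \<in> V" "u \<noteq> v" "\<not> q dvd M u v"
      and piv: "\<And>s t. s \<in> V \<Longrightarrow> t \<in> V \<Longrightarrow> s \<noteq> t \<Longrightarrow> \<exists>l. q dvd M s t - l * M u v"
      using pivot_entry_exists[OF p q less.prems True] by metis
    let ?V = "V - {u, v}"
    have "\<forall>s\<in>?V. \<exists>l. q dvd M s v - l * M u v" using piv uv by auto
    then obtain l where l: "\<And>s. s \<in> ?V \<Longrightarrow> q dvd M s v - l s * M u v" by metis
    \<comment> \<open>Row operation with the pivot row \<open>u\<close> that clears column
      \<open>v\<close> modulo \<open>q\<close>.\<close>
    define M' where "M' s t = M s t - l s * M u t" for s t
    have "card ?V < card V" using less.prems uv by (intro psubset_card_mono) auto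
    from less.hyps[OF this finite_Diff[OF less.prems], of M'] obtain A B L where
      AB: "A \<subseteq> ?V" "B \<subseteq> ?V" "A \<inter> B = {}" "card B = card A" "indep_mod p q A B M'"
      and L: "\<forall>s\<in>?V - A - B. \<forall>t\<in>?V - A - B. s \<noteq> t \<longrightarrow>
                q dvd M' s t - (\<Sum>a\<in>A. L s a * M' a t)"
      by (elim exE conjE) (rule that)
    have fin: "finite A" "finite B" using AB less.prems finite_subset by blast+
    have notin: "u \<notin> A" "v \<notin> A" "u \<notin> B" "v \<notin> B" using AB by auto
    have ind: "indep_mod p q (insert u A) (insert v B) M"
      unfolding indep_mod_def
    proof (intro allI impI)
      fix c assume c: "\<forall>j\<in>insert v B. q dvd (\<Sum>i\<in>insert u A. c i * M i j)"
      \<comment> \<open>The coefficient of row \<open>u\<close> once the relation is rewritten in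
        the rows of \<open>M'\<close>. Column \<open>v\<close> isolates it, since \<open>M'\<close>
        vanishes there modulo \<open>q\<close>.\<close>
      define c0 where "c0 = c u + (\<Sum>a\<in>A. c a * l a)"
      have ex: "(\<Sum>i\<in>insert u A. c i * M i j) = c0 * M u j + (\<Sum>a\<in>A. c a * M' a j)" for j
        using fin notin by (simp add: c0_def M'_def algebra_simps sum.distrib sum_subtractf sum_distrib_left)
      have "q dvd (\<Sum>a\<in>A. c a * M' a v)"
        using l AB(1) by (intro dvd_sum dvd_mult) (auto simp: M'_def)
      moreover have "q dvd c0 * M u v + (\<Sum>a\<in>A. c a * M' a v)" using c ex[of v] by auto
      ultimately have c0v: "q dvd c0 * M u v" by (simp add: dvd_add_left_iff)
      \<comment> \<open>Entries of row \<open>u\<close> are multiples of the pivot, so this row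
        drops out on \<open>B\<close> and the independence of \<open>A\<close> for \<open>M'\<close>
        applies.\<close>
      have c0j: "q dvd c0 * M u j" if j: "j \<in> B" for j
      proof -
        obtain k where "q dvd M u j - k * M u v" using piv[of u j] uv AB j notin by blast
        then have "q dvd c0 * (M u j - k * M u v) + k * (c0 * M u v)"
          using c0v by (intro dvd_add) (erule dvd_mult)+
        then show ?thesis by (simp add: algebra_simps)
      qed
      have "q dvd (\<Sum>a\<in>A. c a * M' a j)" if j: "j \<in> B" for j
      proof -
        have "q dvd c0 * M u j + (\<Sum>a\<in>A. c a * M' a j)" using c ex[of j] j by auto
        then show ?thesis using c0j[OF j] by (simp add: dvd_add_right_iff)
      qed
      then have cA: "\<forall>a\<in>A. p dvd c a" using AB(5) unfolding indep_mod_def by blast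
      have "p dvd c0"
      proof (rule ccontr)
        assume "\<not> p dvd c0"
        then have "coprime q c0" using p unfolding q by (simp add: prime_imp_coprime)
        then show False using c0v uv(4) by (simp add: coprime_dvd_mult_right_iff)
      qed
      moreover have "p dvd (\<Sum>a\<in>A. c a * l a)" using cA by (intro dvd_sum dvd_mult2) auto
      ultimately have "p dvd c u" unfolding c0_def by (simp add: dvd_add_left_iff)
      then show "\<forall>i\<in>insert u A. p dvd c i" using cA by simp
    qed
    \<comment> \<open>Substituting the definition of \<open>M'\<close> back in collects all
      multiples of row \<open>u\<close> in the coefficient at \<open>a = u\<close>.\<close>
    define L' where "L' s a = (if a = u then l s - (\<Sum>b\<in>A. L s b * l b) else L s a)" for s a
    have "q dvd M s t - (\<Sum>a\<in>insert u A. L' s a * M a t)"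
      if "s \<in> V - insert u A - insert v B" "t \<in> V - insert u A - insert v B" "s \<noteq> t" for s t
    proof -
      have "(\<Sum>a\<in>A. L' s a * M a t) = (\<Sum>a\<in>A. L s a * M a t)"
        using notin by (intro sum.cong) (auto simp: L'_def)
      then have "M s t - (\<Sum>a\<in>insert u A. L' s a * M a t) = M' s t - (\<Sum>a\<in>A. L s a * M' a t)"
        using fin notin
        by (simp add: L'_def M'_def algebra_simps sum.distrib sum_subtractf sum_distrib_left)
      then show ?thesis using L that by auto
    qed
    moreover have "insert u A \<subseteq> V" "insert v B \<subseteq> V" "insert u A \<inter> insert v B = {}"
      "card (insert v B) = card (insert u A)"
      using AB uv notin fin by auto
    ultimately show ?thesis using ind by (intro exI[of _ "insert u A"] exI[of _ "insert v B"] exI[of _ L']) auto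
  qed
qed

text \<open>Take \<open>I\<close> maximal. Adding a row \<open>u\<close> creates a relation whose
  coefficient at \<open>u\<close> is odd, because \<open>I\<close> alone is independent; so row
  \<open>u\<close> is a combination of the rows in \<open>I\<close> modulo 2.\<close>

lemma indep_rows_mod_2_exists:
  fixes M :: "'a \<Rightarrow> 'a \<Rightarrow> int"
  assumes V: "finite V"
  obtains I where "I \<subseteq> V" "indep_mod 2 2 I V M"
    "\<And>z u. (\<And>i. i \<in> I \<Longrightarrow> even (\<Sum>j\<in>V. M i j * z j)) \<Longrightarrow> u \<in> V \<Longrightarrow> even (\<Sum>j\<in>V. M u j * z j)"
proof -
  let ?S = "{I. I \<subseteq> V \<and> indep_mod 2 2 I V M}"
  have "finite ?S" using V by simp
  moreover have "{} \<in> ?S" by (simp add: indep_mod_def)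
  ultimately obtain I where I: "I \<in> ?S" "\<And>J. J \<in> ?S \<Longrightarrow> I \<subseteq> J \<Longrightarrow> J = I"
    using finite_has_maximal[of ?S] by (metis (no_types, lifting) empty_iff)
  have fI: "finite I" using I V finite_subset by blast
  have "even (\<Sum>j\<in>V. M u j * z j)" if z: "\<And>i. i \<in> I \<Longrightarrow> even (\<Sum>j\<in>V. M i j * z j)" and u: "u \<in> V" for z u
  proof (cases "u \<in> I")
    case False
    then have "\<not> indep_mod 2 2 (insert u I) V M" using I u by blast
    then obtain c i where c: "\<And>j. j \<in> V \<Longrightarrow> even (\<Sum>i\<in>insert u I. c i * M i j)" "i \<in> insert u I" "odd (c i)"
      unfolding indep_mod_def by auto
    have cu: "odd (c u)"
    proof
      assume e: "even (c u)"
      have "even (\<Sum>i\<in>I. c i * M i j)" if "j \<in> V" for j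
        using c(1)[OF that] e False fI by simp
      then have "\<forall>i\<in>I. even (c i)" using I(1) unfolding indep_mod_def by blast
      then show False using c(2,3) e by auto
    qed
    have "even (\<Sum>j\<in>V. (\<Sum>i\<in>insert u I. c i * M i j) * z j)"
      using c(1) by (intro dvd_sum[of V] dvd_mult2)
    also have "(\<Sum>j\<in>V. (\<Sum>i\<in>insert u I. c i * M i j) * z j)
       = (\<Sum>i\<in>insert u I. c i * (\<Sum>j\<in>V. M i j * z j))"
      by (simp only: sum_distrib_left sum_distrib_right mult.assoc) (rule sum.swap)
    also have "\<dots> = c u * (\<Sum>j\<in>V. M u j * z j) + (\<Sum>i\<in>I. c i * (\<Sum>j\<in>V. M i j * z j))"
      using False fI by simp
    finally have "even (c u * (\<Sum>j\<in>V. M u j * z j) + (\<Sum>i\<in>I. c i * (\<Sum>j\<in>V. M i j * z j)))" .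
    moreover have "even (\<Sum>i\<in>I. c i * (\<Sum>j\<in>V. M i j * z j))" using z by (intro dvd_sum[of I] dvd_mult)
    ultimately show ?thesis using cu by simp
  qed (use z in simp)
  then show thesis using that[of I] I(1) by blast
qed

section \<open>Exponential sums over the cube\<close>

lemma e_char_add: "e_char m (a + b) = e_char m a * e_char m b"
  by (simp add: e_char_def add_divide_distrib distrib_left flip: exp_add)

lemma e_char_0 [simp]: "e_char m 0 = 1"
  by (simp add: e_char_def)

lemma norm_e_char [simp]: "cmod (e_char m a) = 1"
  by (simp add: e_char_def norm_exp_eq_Re)

lemma cnj_e_char: "cnj (e_char m a) = e_char m (- a)"
  by (simp add: e_char_def exp_cnj)

lemma e_char_sum: "e_char m (\<Sum>i\<in>Y. d i) = (\<Prod>i\<in>Y. e_char m (d i))"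
  by (induction Y rule: infinite_finite_induct) (simp_all add: e_char_add)

lemma e_char_power: "e_char m d ^ k = e_char m (int k * d)"
  by (induction k) (simp_all add: e_char_add distrib_right)

lemma e_char_eq_1_iff:
  assumes "m > 0"
  shows "e_char m d = 1 \<longleftrightarrow> int m dvd d"
proof -
  have "e_char m d = exp (\<i> * of_real (2 * pi * of_int d / of_nat m))"
    by (simp add: e_char_def mult_ac)
  then have "e_char m d = 1 \<longleftrightarrow> (\<exists>k::int. 2 * pi * of_int d / of_nat m = of_int (2 * k) * pi)"
    by (simp add: exp_eq_1)
  also have "\<dots> \<longleftrightarrow> (\<exists>k::int. (of_int d :: real) = of_int (int m * k))"
    using assms by (intro ex_cong1) (simp add: field_simps)
  also have "\<dots> \<longleftrightarrow> int m dvd d"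
    by (simp only: of_int_eq_iff dvd_def)
  finally show ?thesis .
qed

text \<open>For an \<open>m\<close>-th root of unity \<open>\<zeta> \<noteq> 1\<close>, the telescoping identity
  \<open>(1 - \<zeta>) (1 + 2\<zeta> + \<dots> + m\<zeta>\<^bsup>m-1\<^esup>) = -m\<close> keeps \<open>\<zeta>\<close> away from \<open>1\<close>.\<close>

lemma norm_one_plus_e_char_le:
  assumes m: "m > 1" and d: "\<not> int m dvd d"
  shows "cmod (1 + e_char m d) \<le> 2 * (1 - 1 / (8 * real m ^ 2))"
proof -
  define z where "z = e_char m d"
  have z1: "z \<noteq> 1" and zm: "z ^ m = 1" and nz: "cmod z = 1"
    using m d by (simp_all add: z_def e_char_power e_char_eq_1_iff)
  have "(1 - z) * (\<Sum>k<n. of_nat (Suc k) * z ^ k) = (\<Sum>k<n. z ^ k) - of_nat n * z ^ n" for n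
  proof (induction n)
    case (Suc n)
    have "(1 - z) * (\<Sum>k<Suc n. of_nat (Suc k) * z ^ k)
       = (1 - z) * (\<Sum>k<n. of_nat (Suc k) * z ^ k) + (1 - z) * (of_nat (Suc n) * z ^ n)"
      by (simp only: sum.lessThan_Suc distrib_left)
    also have "\<dots> = (\<Sum>k<Suc n. z ^ k) - of_nat (Suc n) * z ^ Suc n"
      unfolding Suc.IH by (simp add: algebra_simps)
    finally show ?case .
  qed simp
  moreover have "(\<Sum>k<m. z ^ k) = 0"
    using z1 zm by (simp add: geometric_sum)
  ultimately have "(1 - z) * (\<Sum>k<m. of_nat (Suc k) * z ^ k) = - of_nat m"
    using zm by simp
  then have "cmod (1 - z) * cmod (\<Sum>k<m. of_nat (Suc k) * z ^ k) = real m"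
    by (metis norm_minus_cancel norm_mult norm_of_nat)
  moreover have "cmod (1 - z) * cmod (\<Sum>k<m. of_nat (Suc k) * z ^ k) \<le> cmod (1 - z) * (real m * real m)"
  proof -
    have "cmod (\<Sum>k<m. of_nat (Suc k) * z ^ k) \<le> (\<Sum>k<m. cmod (of_nat (Suc k) * z ^ k))"
      by (rule norm_sum)
    also have "\<dots> \<le> (\<Sum>k<m. real m)"
      by (intro sum_mono) (simp add: norm_mult norm_power nz del: of_nat_Suc)
    finally show ?thesis by (intro mult_left_mono) auto
  qed
  ultimately have "real m \<le> cmod (1 - z) * (real m * real m)" by simp
  then have far: "1 / real m \<le> cmod (1 - z)" using m by (simp add: field_simps)
  \<comment> \<open>The parallelogram law turns the distance of \<open>z\<close> from
    \<open>1\<close> into a deficit of \<open>1 + z\<close>.\<close>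
  have par: "(cmod (1 + z))\<^sup>2 + (cmod (1 - z))\<^sup>2 = 4"
  proof -
    have "(Re z)\<^sup>2 + (Im z)\<^sup>2 = 1" using nz by (simp flip: cmod_power2)
    then show ?thesis unfolding cmod_power2 by (simp add: power2_eq_square algebra_simps)
  qed
  have "(1 / real m)\<^sup>2 \<le> (cmod (1 - z))\<^sup>2" using far by (intro power_mono) auto
  then have "(cmod (1 + z))\<^sup>2 \<le> 4 - 1 / real m ^ 2" using par by (simp add: power_divide)
  \<comment> \<open>The constant 8 makes the terms in \<open>1/m^2\<close> match; the square exceeds
    the left side by \<open>1/(16 m^4)\<close>.\<close>
  also have "\<dots> \<le> (2 * (1 - 1 / (8 * real m ^ 2)))\<^sup>2"
    by (simp add: power2_diff power_mult_distrib power_divide)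
  finally have sq: "(cmod (1 + z))\<^sup>2 \<le> (2 * (1 - 1 / (8 * real m ^ 2)))\<^sup>2" .
  have "1 \<le> real m ^ 2" using m by simp
  then have "1 / (8 * real m ^ 2) \<le> 1" by (intro divide_le_eq_1_pos[THEN iffD2]) linarith+
  then have "0 \<le> 2 * (1 - 1 / (8 * real m ^ 2))" by (intro mult_nonneg_nonneg) simp_all
  with sq show ?thesis unfolding z_def by (rule power2_le_imp_le)
qed

text \<open>An exponent affine in \<open>Y\<close> makes the sum a product of factors
  \<open>1 + e_char m (d i)\<close>; a factor with \<open>q\<close> not dividing \<open>d i\<close>
  is one with \<open>m\<close> not dividing \<open>d i\<close>, so it saves
  \<open>\<alpha>\<close>.\<close>

lemma norm_sum_Pow_e_char_le:
  assumes A: "finite A" and q: "q dvd int m" and \<alpha>: "0 \<le> \<alpha>"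
    and bound: "\<And>d. \<not> int m dvd d \<Longrightarrow> cmod (1 + e_char m d) \<le> 2 * \<alpha>"
  shows "cmod (\<Sum>Y\<in>Pow A. e_char m (c + (\<Sum>i\<in>Y. d i)))
           \<le> 2 ^ card A * (\<Prod>i\<in>A. if q dvd d i then 1 else \<alpha>)"
proof -
  have "(\<Sum>Y\<in>Pow A. e_char m (c + (\<Sum>i\<in>Y. d i))) = e_char m c * (\<Prod>i\<in>A. e_char m (d i) + 1)"
    using A by (simp add: e_char_add e_char_sum prod_add sum_distrib_left)
  then have "cmod (\<Sum>Y\<in>Pow A. e_char m (c + (\<Sum>i\<in>Y. d i))) = (\<Prod>i\<in>A. cmod (e_char m (d i) + 1))"
    by (simp add: norm_mult prod_norm)
  also have "\<dots> \<le> (\<Prod>i\<in>A. 2 * (if q dvd d i then 1 else \<alpha>))"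
  proof (intro prod_mono conjI)
    fix i
    show "cmod (e_char m (d i) + 1) \<le> 2 * (if q dvd d i then 1 else \<alpha>)"
    proof (cases "q dvd d i")
      case True
      then show ?thesis using norm_triangle_ineq[of "e_char m (d i)" 1] by simp
    next
      case False
      then have "\<not> int m dvd d i" using q dvd_trans by blast
      then show ?thesis using bound[of "d i"] False by (simp add: add.commute)
    qed
  qed simp
  finally show ?thesis using A by (simp add: prod.distrib)
qed

lemma norm_power2_sum_e_char:
  "complex_of_real ((cmod (\<Sum>x\<in>S. e_char m (g x)))\<^sup>2) = (\<Sum>x\<in>S. \<Sum>y\<in>S. e_char m (g x - g y))"
proof -
  have "e_char m (g x - g y) = e_char m (g x) * cnj (e_char m (g y))" for x y
    using e_char_add[of m "g x" "- g y"] by (simp add: cnj_e_char)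
  then show ?thesis
    unfolding complex_norm_square by (simp add: sum_product)
qed

lemma sum_Pow_split:
  assumes "H \<subseteq> V" "finite V"
  shows "(\<Sum>X\<in>Pow V. g X) = (\<Sum>Y\<in>Pow H. \<Sum>Z\<in>Pow (V - H). g (Y \<union> Z))"
proof -
  have "(\<Sum>Y\<in>Pow H. \<Sum>Z\<in>Pow (V - H). g (Y \<union> Z)) = (\<Sum>(Y, Z)\<in>Pow H \<times> Pow (V - H). g (Y \<union> Z))"
    by (rule sum.cartesian_product)
  also have "\<dots> = (\<Sum>X\<in>Pow V. g X)"
    using assms
    by (intro sum.reindex_bij_witness[of _ "\<lambda>X. (X \<inter> H, X - H)" "\<lambda>(Y, Z). Y \<union> Z"]) auto
  finally show ?thesis ..
qed

text \<open>A subset \<open>X\<close> stands for the point with this indicator. The equation is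
  doubled because the symmetric sum counts every pair twice; squares belong to \<open>b\<close>, as
  \<open>x^2 = x\<close> on the cube, which allows a zero diagonal.\<close>

locale cube_quadratic =
  fixes V :: "'a set" and c :: int and b :: "'a \<Rightarrow> int" and M :: "'a \<Rightarrow> 'a \<Rightarrow> int"
    and F :: "'a set \<Rightarrow> int"
  assumes finite_V: "finite V"
    and sym: "M i j = M j i"
    and diag: "M i i = 0"
    and F: "X \<subseteq> V \<Longrightarrow> 2 * F X = 2 * c + 2 * (\<Sum>i\<in>X. b i) + (\<Sum>i\<in>X. \<Sum>j\<in>X. M i j)"
begin

lemma F_Un:
  assumes "Y \<subseteq> V" "Z \<subseteq> V" "Y \<inter> Z = {}"
  shows "F (Y \<union> Z) = F Y + F Z - c + (\<Sum>i\<in>Y. \<Sum>j\<in>Z. M i j)"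
proof -
  have fin: "finite Y" "finite Z" using assms(1,2) finite_V finite_subset by blast+
  have "(\<Sum>i\<in>Z. \<Sum>j\<in>Y. M i j) = (\<Sum>i\<in>Y. \<Sum>j\<in>Z. M i j)"
    by (subst sum.swap) (simp add: sym)
  then have "2 * F (Y \<union> Z) = 2 * (F Y + F Z - c + (\<Sum>i\<in>Y. \<Sum>j\<in>Z. M i j))"
    using assms F[of Y] F[of Z] F[of "Y \<union> Z"] fin
    by (simp add: sum.union_disjoint sum.distrib algebra_simps)
  then show ?thesis by simp
qed

text \<open>The part quadratic in \<open>Y\<close> is the same in \<open>F (H - Y)\<close> and
  \<open>F Y\<close>, so the difference is affine in \<open>Y\<close>.\<close>

lemma F_complement:
  assumes "Y \<subseteq> H" "H \<subseteq> V"
  shows "F (H - Y) - F Y = F H - c + (\<Sum>i\<in>Y. - 2 * b i - (\<Sum>j\<in>H. M i j))"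
proof -
  have fin: "finite H" "finite Y" using assms finite_V by (auto intro: finite_subset)
  have H: "Y \<union> (H - Y) = H" using assms by auto
  have "F H = F Y + F (H - Y) - c + (\<Sum>i\<in>Y. \<Sum>j\<in>H - Y. M i j)"
    using F_Un[of Y "H - Y"] assms unfolding H by auto
  moreover have "2 * F Y = 2 * c + 2 * (\<Sum>i\<in>Y. b i) + (\<Sum>i\<in>Y. \<Sum>j\<in>Y. M i j)"
    using F[of Y] assms by simp
  moreover have "(\<Sum>i\<in>Y. \<Sum>j\<in>H - Y. M i j) = (\<Sum>i\<in>Y. \<Sum>j\<in>H. M i j) - (\<Sum>i\<in>Y. \<Sum>j\<in>Y. M i j)"
    using fin assms by (simp add: sum_diff sum_subtractf)
  ultimately show ?thesis
    by (simp add: sum_subtractf sum_negf sum_distrib_left)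
qed

end

section \<open>Bias bounds with an abstract contraction factor \<open>\<alpha>\<close>\<close>

locale cube_quadratic_mod = cube_quadratic +
  fixes m :: nat and \<alpha> :: real
  assumes \<alpha>: "0 \<le> \<alpha>" "\<alpha> \<le> 1"
    and bound: "\<And>d. \<not> int m dvd d \<Longrightarrow> cmod (1 + e_char m d) \<le> 2 * \<alpha>"
begin

text \<open>Cauchy-Schwarz over \<open>Y \<subseteq> A\<close> removes the terms depending on
  \<open>Y\<close> alone. In the expanded square the sum over \<open>Y\<close> saves a factor
  \<open>\<alpha>\<close> for each row of \<open>A\<close> whose sums over \<open>Z\<close> and
  \<open>Z'\<close> differ modulo \<open>q\<close>; for fixed \<open>Z'\<close>, independence makes
  it rare that many of them agree.\<close>

lemma bias_le_off_diagonal: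
  assumes p: "prime p" and q: "q = p ^ a" "q dvd int m" and A: "A \<subseteq> V"
    and ind: "indep_mod p q A (V - A) M"
  shows "(cmod (\<Sum>X\<in>Pow V. e_char m (F X)))\<^sup>2 \<le> 4 ^ card V * ((1 + \<alpha>) / 2) ^ card A"
proof -
  let ?D = "V - A"
  have fin: "finite A" "finite ?D" using A finite_V finite_subset by auto
  have cV: "card V = card A + card ?D"
    using A fin finite_V by (simp add: card_Diff_subset card_mono)
  define h where "h Y Z = F Z + (\<Sum>i\<in>Y. \<Sum>j\<in>Z. M i j)" for Y Z
  have "(\<Sum>X\<in>Pow V. e_char m (F X)) = (\<Sum>Y\<in>Pow A. \<Sum>Z\<in>Pow ?D. e_char m (F (Y \<union> Z)))"
    by (rule sum_Pow_split[OF A finite_V])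
  also have "\<dots> = (\<Sum>Y\<in>Pow A. \<Sum>Z\<in>Pow ?D. e_char m ((F Y - c) + h Y Z))"
  proof (intro sum.cong refl arg_cong[of _ _ "e_char m"])
    fix Y Z assume "Y \<in> Pow A" "Z \<in> Pow ?D"
    then show "F (Y \<union> Z) = (F Y - c) + h Y Z"
      using A by (subst F_Un) (auto simp: h_def)
  qed
  also have "\<dots> = (\<Sum>Y\<in>Pow A. e_char m (F Y - c) * (\<Sum>Z\<in>Pow ?D. e_char m (h Y Z)))"
    by (simp add: e_char_add sum_distrib_left)
  finally have "cmod (\<Sum>X\<in>Pow V. e_char m (F X))
     \<le> (\<Sum>Y\<in>Pow A. cmod (\<Sum>Z\<in>Pow ?D. e_char m (h Y Z)))"
    by (simp add: norm_mult order.trans[OF norm_sum])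
  then have "(cmod (\<Sum>X\<in>Pow V. e_char m (F X)))\<^sup>2
     \<le> (\<Sum>Y\<in>Pow A. cmod (\<Sum>Z\<in>Pow ?D. e_char m (h Y Z)))\<^sup>2"
    by (intro power_mono) auto
  also have "\<dots> \<le> (\<Sum>Y\<in>Pow A. (cmod (\<Sum>Z\<in>Pow ?D. e_char m (h Y Z)))\<^sup>2) * real (card (Pow A))"
    by (rule sum_squared_le_sum_of_squares)
  also have "(\<Sum>Y\<in>Pow A. (cmod (\<Sum>Z\<in>Pow ?D. e_char m (h Y Z)))\<^sup>2)
     \<le> 2 ^ card ?D * (2 ^ card A * (2 ^ card ?D * ((1 + \<alpha>) / 2) ^ card A))"
  proof -
    have "complex_of_real (\<Sum>Y\<in>Pow A. (cmod (\<Sum>Z\<in>Pow ?D. e_char m (h Y Z)))\<^sup>2)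
       = (\<Sum>Y\<in>Pow A. \<Sum>Z\<in>Pow ?D. \<Sum>Z'\<in>Pow ?D. e_char m (h Y Z - h Y Z'))"
      by (simp only: of_real_sum norm_power2_sum_e_char)
    \<comment> \<open>Reordering makes \<open>Y\<close> the innermost variable, in which the
      exponent is affine.\<close>
    also have "\<dots> = (\<Sum>Z\<in>Pow ?D. \<Sum>Y\<in>Pow A. \<Sum>Z'\<in>Pow ?D. e_char m (h Y Z - h Y Z'))"
      by (rule sum.swap)
    also have "\<dots> = (\<Sum>Z\<in>Pow ?D. \<Sum>Z'\<in>Pow ?D. \<Sum>Y\<in>Pow A. e_char m (h Y Z - h Y Z'))"
      by (intro sum.cong refl sum.swap)
    also have "\<dots> = (\<Sum>Z'\<in>Pow ?D. \<Sum>Z\<in>Pow ?D. \<Sum>Y\<in>Pow A.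
        e_char m ((F Z - F Z') + (\<Sum>i\<in>Y. (\<Sum>j\<in>Z. M i j) - (\<Sum>j\<in>Z'. M i j))))"
      by (subst sum.swap) (simp add: h_def sum_subtractf algebra_simps)
    finally have eq: "complex_of_real (\<Sum>Y\<in>Pow A. (cmod (\<Sum>Z\<in>Pow ?D. e_char m (h Y Z)))\<^sup>2) = \<dots>" .
    have "(\<Sum>Y\<in>Pow A. (cmod (\<Sum>Z\<in>Pow ?D. e_char m (h Y Z)))\<^sup>2)
       = cmod (complex_of_real (\<Sum>Y\<in>Pow A. (cmod (\<Sum>Z\<in>Pow ?D. e_char m (h Y Z)))\<^sup>2))"
      unfolding norm_of_real by (intro abs_of_nonneg[symmetric] sum_nonneg) simp
    also have "\<dots> \<le> (\<Sum>Z'\<in>Pow ?D. \<Sum>Z\<in>Pow ?D. cmod (\<Sum>Y\<in>Pow A.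
        e_char m ((F Z - F Z') + (\<Sum>i\<in>Y. (\<Sum>j\<in>Z. M i j) - (\<Sum>j\<in>Z'. M i j)))))"
      unfolding eq by (intro order.trans[OF norm_sum] sum_mono norm_sum)
    also have "\<dots> \<le> (\<Sum>Z'\<in>Pow ?D. \<Sum>Z\<in>Pow ?D. 2 ^ card A *
        (\<Prod>i\<in>A. if q dvd (\<Sum>j\<in>Z. M i j) - (\<Sum>j\<in>Z'. M i j) then 1 else \<alpha>))"
      by (intro sum_mono norm_sum_Pow_e_char_le fin q \<alpha> bound)
    also have "\<dots> \<le> (\<Sum>Z'\<in>Pow ?D. 2 ^ card A * (2 ^ card ?D * ((1 + \<alpha>) / 2) ^ card A))"
    proof (rule sum_mono)
      fix Z'
      show "(\<Sum>Z\<in>Pow ?D. 2 ^ card A *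
          (\<Prod>i\<in>A. if q dvd (\<Sum>j\<in>Z. M i j) - (\<Sum>j\<in>Z'. M i j) then 1 else \<alpha>))
        \<le> 2 ^ card A * (2 ^ card ?D * ((1 + \<alpha>) / 2) ^ card A)"
        unfolding sum_distrib_left[symmetric]
        by (intro mult_left_mono indep_mod_weighted_sum[OF p q(1) fin(2,1) ind \<alpha>]) auto
    qed
    also have "\<dots> = 2 ^ card ?D * (2 ^ card A * (2 ^ card ?D * ((1 + \<alpha>) / 2) ^ card A))"
      using fin by (simp add: card_Pow)
    finally show ?thesis .
  qed
  also have "2 ^ card ?D * (2 ^ card A * (2 ^ card ?D * ((1 + \<alpha>) / 2) ^ card A)) * real (card (Pow A))
      = 4 ^ card V * ((1 + \<alpha>) / 2) ^ card A"
  proof -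
    have "(4::real) ^ card V = (2 ^ card V) ^ 2" by (simp flip: power_mult power_mult_distrib add: power2_eq_square)
    then show ?thesis using fin by (simp add: card_Pow cV power_add power2_eq_square)
  qed
  finally show ?thesis by (simp add: mult_right_mono)
qed

end

section \<open>The even case: discrete derivatives\<close>

context cube_quadratic_mod
begin

text \<open>Flipping the coordinates in \<open>H\<close> gives a derivative affine in the part of
  \<open>X\<close> outside \<open>H\<close> and also in the part inside; modulo 2 the coefficients
  are the row sums over \<open>H\<close>. Each order of summation controls only the rows of its own
  part. The geometric mean of the two bounds covers all rows, at the price of
  \<open>sqrt \<alpha>\<close>.\<close>

lemma norm_derivative_sum_le:
  assumes m: "even m" and H: "H \<subseteq> V"
  shows "cmod (\<Sum>X\<in>Pow V. e_char m (F (sym_diff X H) - F X))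
           \<le> 2 ^ card V * (\<Prod>i\<in>V. if even (\<Sum>j\<in>H. M i j) then 1 else sqrt \<alpha>)"
proof -
  let ?w = "\<lambda>i. if even (\<Sum>j\<in>H. M i j) then 1 else \<alpha>"
  let ?S = "\<Sum>X\<in>Pow V. e_char m (F (sym_diff X H) - F X)"
  have m2: "2 dvd int m" using m by simp
  have fin: "finite H" "finite (V - H)" using H finite_V by (auto intro: finite_subset)
  have cV: "card V = card H + card (V - H)"
    using H fin finite_V by (simp add: card_Diff_subset card_mono)
  define D where "D Y Z = F ((H - Y) \<union> Z) - F (Y \<union> Z)" for Y Z
  have D: "D Y Z = F (H - Y) - F Y + (\<Sum>i\<in>H - Y. \<Sum>j\<in>Z. M i j) - (\<Sum>i\<in>Y. \<Sum>j\<in>Z. M i j)"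
    if "Y \<in> Pow H" "Z \<in> Pow (V - H)" for Y Z
  proof -
    have "F ((H - Y) \<union> Z) = F (H - Y) + F Z - c + (\<Sum>i\<in>H - Y. \<Sum>j\<in>Z. M i j)"
      using that H by (intro F_Un) auto
    moreover have "F (Y \<union> Z) = F Y + F Z - c + (\<Sum>i\<in>Y. \<Sum>j\<in>Z. M i j)"
      using that H by (intro F_Un) auto
    ultimately show ?thesis by (simp add: D_def)
  qed
  have S: "?S = (\<Sum>Y\<in>Pow H. \<Sum>Z\<in>Pow (V - H). e_char m (D Y Z))"
  proof -
    have "sym_diff (Y \<union> Z) H = (H - Y) \<union> Z" if "Y \<in> Pow H" "Z \<in> Pow (V - H)" for Y Z
      using that by auto
    then show ?thesis
      unfolding sum_Pow_split[OF H finite_V] by (intro sum.cong refl) (simp add: D_def)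
  qed
  have 1: "cmod ?S \<le> 2 ^ card V * (\<Prod>i\<in>V - H. ?w i)"
  proof -
    have "cmod (\<Sum>Z\<in>Pow (V - H). e_char m (D Y Z)) \<le> 2 ^ card (V - H) * (\<Prod>i\<in>V - H. ?w i)"
      if Y: "Y \<in> Pow H" for Y
    proof -
      let ?d = "\<lambda>j. (\<Sum>i\<in>H - Y. M i j) - (\<Sum>i\<in>Y. M i j)"
      have "D Y Z = (F (H - Y) - F Y) + (\<Sum>j\<in>Z. ?d j)" if "Z \<in> Pow (V - H)" for Z
        unfolding D[OF Y that] sum_subtractf
        by (simp add: sum.swap[of _ Z "H - Y"] sum.swap[of _ Z Y])
      then have "(\<Sum>Z\<in>Pow (V - H). e_char m (D Y Z))
         = (\<Sum>Z\<in>Pow (V - H). e_char m ((F (H - Y) - F Y) + (\<Sum>j\<in>Z. ?d j)))"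
        by (intro sum.cong refl) simp
      moreover have "even (?d j) \<longleftrightarrow> even (\<Sum>i\<in>H. M j i)" for j
      proof -
        have "finite Y" using Y fin(1) by (auto intro: finite_subset)
        then have "(\<Sum>i\<in>H - Y. M i j) = (\<Sum>i\<in>H. M i j) - (\<Sum>i\<in>Y. M i j)"
          using Y fin(1) by (simp add: sum_diff)
        then show ?thesis by (simp add: sym[of j])
      qed
      ultimately show ?thesis
        using norm_sum_Pow_e_char_le[OF fin(2) m2 \<alpha>(1) bound, of "F (H - Y) - F Y" ?d] by simp
    qed
    then have "cmod ?S \<le> (\<Sum>Y\<in>Pow H. 2 ^ card (V - H) * (\<Prod>i\<in>V - H. ?w i))"
      unfolding S by (intro order.trans[OF norm_sum sum_mono])
    also have "\<dots> = 2 ^ card V * (\<Prod>i\<in>V - H. ?w i)"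
      using fin by (simp add: card_Pow cV power_add)
    finally show ?thesis .
  qed
  have 2: "cmod ?S \<le> 2 ^ card V * (\<Prod>i\<in>H. ?w i)"
  proof -
    have "cmod (\<Sum>Y\<in>Pow H. e_char m (D Y Z)) \<le> 2 ^ card H * (\<Prod>i\<in>H. ?w i)"
      if Z: "Z \<in> Pow (V - H)" for Z
    proof -
      let ?d = "\<lambda>i. - 2 * b i - (\<Sum>j\<in>H. M i j) - 2 * (\<Sum>j\<in>Z. M i j)"
      let ?c = "F H - c + (\<Sum>i\<in>H. \<Sum>j\<in>Z. M i j)"
      have "D Y Z = ?c + (\<Sum>i\<in>Y. ?d i)" if Y: "Y \<in> Pow H" for Y
      proof -
        have "finite Y" using Y fin(1) by (auto intro: finite_subset)
        then have "(\<Sum>i\<in>H - Y. \<Sum>j\<in>Z. M i j) = (\<Sum>i\<in>H. \<Sum>j\<in>Z. M i j) - (\<Sum>i\<in>Y. \<Sum>j\<in>Z. M i j)"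
          using Y fin(1) by (simp add: sum_diff)
        moreover have "F (H - Y) - F Y = F H - c + (\<Sum>i\<in>Y. - 2 * b i - (\<Sum>j\<in>H. M i j))"
          using Y H by (intro F_complement) auto
        ultimately show ?thesis
          unfolding D[OF Y Z] by (simp add: sum_subtractf sum_negf sum_distrib_left)
      qed
      then have "(\<Sum>Y\<in>Pow H. e_char m (D Y Z)) = (\<Sum>Y\<in>Pow H. e_char m (?c + (\<Sum>i\<in>Y. ?d i)))"
        by (intro sum.cong refl) simp
      moreover have "even (?d j) \<longleftrightarrow> even (\<Sum>i\<in>H. M j i)" for j by simp
      ultimately show ?thesis
        using norm_sum_Pow_e_char_le[OF fin(1) m2 \<alpha>(1) bound, of ?c ?d] by simp
    qed
    then have "cmod (\<Sum>Z\<in>Pow (V - H). \<Sum>Y\<in>Pow H. e_char m (D Y Z))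
       \<le> (\<Sum>Z\<in>Pow (V - H). 2 ^ card H * (\<Prod>i\<in>H. ?w i))"
      by (intro order.trans[OF norm_sum sum_mono])
    also have "\<dots> = 2 ^ card V * (\<Prod>i\<in>H. ?w i)"
      using fin by (simp add: card_Pow cV power_add)
    finally show ?thesis unfolding S by (subst sum.swap)
  qed
  have w: "0 \<le> ?w i" for i using \<alpha> by simp
  have "(cmod ?S)\<^sup>2 \<le> (2 ^ card V * (\<Prod>i\<in>V - H. ?w i)) * (2 ^ card V * (\<Prod>i\<in>H. ?w i))"
    unfolding power2_eq_square using w by (intro mult_mono 1 2 mult_nonneg_nonneg prod_nonneg) auto
  also have "\<dots> = (2 ^ card V)\<^sup>2 * ((\<Prod>i\<in>V - H. ?w i) * (\<Prod>i\<in>H. ?w i))"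
    by (simp add: power2_eq_square)
  also have "(\<Prod>i\<in>V - H. ?w i) * (\<Prod>i\<in>H. ?w i) = (\<Prod>i\<in>V. ?w i)"
    using prod.subset_diff[OF H finite_V, of ?w] by simp
  also have "\<dots> = (\<Prod>i\<in>V. if even (\<Sum>j\<in>H. M i j) then 1 else sqrt \<alpha>)\<^sup>2"
    unfolding prod_power_distrib using \<alpha> by (intro prod.cong) auto
  also have "(2 ^ card V)\<^sup>2 * \<dots> = (2 ^ card V * (\<Prod>i\<in>V. if even (\<Sum>j\<in>H. M i j) then 1 else sqrt \<alpha>))\<^sup>2"
    by (simp add: power_mult_distrib)
  finally show ?thesis
    using \<alpha> by (intro power2_le_imp_le[of "cmod ?S"]) (auto intro!: mult_nonneg_nonneg prod_nonneg)
qed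

text \<open>The squared modulus is a sum of derivative sums over all shifts \<open>H\<close>. Each
  odd row sum over \<open>H\<close> saves a factor, and independence modulo 2 makes shifts with many
  even row sums in \<open>I\<close> rare.\<close>

lemma bias_le_even:
  assumes m: "even m" and I: "I \<subseteq> V" and ind: "indep_mod 2 2 I V M"
  shows "(cmod (\<Sum>X\<in>Pow V. e_char m (F X)))\<^sup>2 \<le> 4 ^ card V * ((1 + sqrt \<alpha>) / 2) ^ card I"
proof -
  have fI: "finite I" using I finite_V by (auto intro: finite_subset)
  have "complex_of_real ((cmod (\<Sum>X\<in>Pow V. e_char m (F X)))\<^sup>2)
     = (\<Sum>X'\<in>Pow V. \<Sum>X\<in>Pow V. e_char m (F X' - F X))"
    by (rule norm_power2_sum_e_char)
  also have "\<dots> = (\<Sum>X\<in>Pow V. \<Sum>X'\<in>Pow V. e_char m (F X' - F X))"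
    by (rule sum.swap)
  also have "\<dots> = (\<Sum>X\<in>Pow V. \<Sum>H\<in>Pow V. e_char m (F (sym_diff X H) - F X))"
  proof (rule sum.cong[OF refl])
    fix X assume X: "X \<in> Pow V"
    have inv: "sym_diff X (sym_diff X H) = H" for H by auto
    show "(\<Sum>X'\<in>Pow V. e_char m (F X' - F X)) = (\<Sum>H\<in>Pow V. e_char m (F (sym_diff X H) - F X))"
      by (rule sum.reindex_bij_witness[of _ "\<lambda>H. sym_diff X H" "\<lambda>H. sym_diff X H"])
        (simp_all only: inv, use X in auto)
  qed
  also have "\<dots> = (\<Sum>H\<in>Pow V. \<Sum>X\<in>Pow V. e_char m (F (sym_diff X H) - F X))"
    by (rule sum.swap)
  finally have eq: "complex_of_real ((cmod (\<Sum>X\<in>Pow V. e_char m (F X)))\<^sup>2) = \<dots>" .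
  have "(cmod (\<Sum>X\<in>Pow V. e_char m (F X)))\<^sup>2
     = cmod (complex_of_real ((cmod (\<Sum>X\<in>Pow V. e_char m (F X)))\<^sup>2))"
    unfolding norm_of_real by simp
  also have "\<dots> \<le> (\<Sum>H\<in>Pow V. cmod (\<Sum>X\<in>Pow V. e_char m (F (sym_diff X H) - F X)))"
    unfolding eq by (rule norm_sum)
  also have "\<dots> \<le> (\<Sum>H\<in>Pow V. 2 ^ card V *
      (\<Prod>i\<in>I. if 2 dvd (\<Sum>j\<in>H. M i j) - 0 then 1 else sqrt \<alpha>))"
  proof (rule sum_mono)
    fix H assume "H \<in> Pow V"
    then have "cmod (\<Sum>X\<in>Pow V. e_char m (F (sym_diff X H) - F X))
       \<le> 2 ^ card V * (\<Prod>i\<in>V. if even (\<Sum>j\<in>H. M i j) then 1 else sqrt \<alpha>)"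
      by (intro norm_derivative_sum_le m) simp
    also have "(\<Prod>i\<in>V. if even (\<Sum>j\<in>H. M i j) then 1 else sqrt \<alpha>)
       = (\<Prod>i\<in>V - I. if even (\<Sum>j\<in>H. M i j) then 1 else sqrt \<alpha>) *
         (\<Prod>i\<in>I. if even (\<Sum>j\<in>H. M i j) then 1 else sqrt \<alpha>)"
      by (rule prod.subset_diff[OF I finite_V])
    also have "\<dots> \<le> 1 * (\<Prod>i\<in>I. if even (\<Sum>j\<in>H. M i j) then 1 else sqrt \<alpha>)"
      using \<alpha> by (intro mult_right_mono prod_le_1 prod_nonneg) auto
    finally show "cmod (\<Sum>X\<in>Pow V. e_char m (F (sym_diff X H) - F X))
       \<le> 2 ^ card V * (\<Prod>i\<in>I. if 2 dvd (\<Sum>j\<in>H. M i j) - 0 then 1 else sqrt \<alpha>)"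
      by simp
  qed
  also have "\<dots> \<le> 2 ^ card V * (2 ^ card V * ((1 + sqrt \<alpha>) / 2) ^ card I)"
    unfolding sum_distrib_left[symmetric]
    using \<alpha> by (intro mult_left_mono indep_mod_weighted_sum[where p = 2 and a = 1] finite_V fI ind) auto
  also have "\<dots> = 4 ^ card V * ((1 + sqrt \<alpha>) / 2) ^ card I"
    by (simp flip: power_mult_distrib)
  finally show ?thesis .
qed

end

text \<open>Pairing \<open>Z\<close> with \<open>{u} \<union> Z\<close> shifts the phase by
  \<open>b u\<close> plus a multiple of \<open>q\<close>, hence by a nonmultiple of
  \<open>m\<close>, so every pair saves \<open>\<alpha>\<close>.\<close>

lemma (in cube_quadratic_mod) bias_le_linear:
  assumes u: "u \<in> V" and q: "q dvd int m" and M: "\<And>j. j \<in> V \<Longrightarrow> q dvd M u j" and b: "\<not> q dvd b u"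
  shows "cmod (\<Sum>X\<in>Pow V. e_char m (F X)) \<le> 2 ^ card V * \<alpha>"
proof -
  have u': "{u} \<subseteq> V" using u by simp
  have Pu: "(\<Sum>Y\<in>Pow {u}. h Y) = h {} + h {u}" for h :: "'a set \<Rightarrow> complex"
    by (simp add: Pow_insert)
  have "(\<Sum>X\<in>Pow V. e_char m (F X)) = (\<Sum>Z\<in>Pow (V - {u}). \<Sum>Y\<in>Pow {u}. e_char m (F (Y \<union> Z)))"
    unfolding sum_Pow_split[OF u' finite_V] by (rule sum.swap)
  also have "\<dots> = (\<Sum>Z\<in>Pow (V - {u}). e_char m (F Z) * (1 + e_char m (b u + (\<Sum>j\<in>Z. M u j))))"
  proof (rule sum.cong[OF refl])
    fix Z assume Z: "Z \<in> Pow (V - {u})"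
    have "F ({u} \<union> Z) = F {u} + F Z - c + (\<Sum>j\<in>Z. M u j)"
      using F_Un[of "{u}" Z] Z u by auto
    moreover have "F {u} = c + b u" using F[OF u'] diag[of u] by simp
    ultimately have "F ({u} \<union> Z) = F Z + (b u + (\<Sum>j\<in>Z. M u j))" by simp
    then show "(\<Sum>Y\<in>Pow {u}. e_char m (F (Y \<union> Z))) = e_char m (F Z) * (1 + e_char m (b u + (\<Sum>j\<in>Z. M u j)))"
      unfolding Pu by (simp add: e_char_add distrib_left)
  qed
  finally have "cmod (\<Sum>X\<in>Pow V. e_char m (F X))
     \<le> (\<Sum>Z\<in>Pow (V - {u}). cmod (e_char m (F Z) * (1 + e_char m (b u + (\<Sum>j\<in>Z. M u j)))))"
    by (simp only: norm_sum)
  also have "\<dots> \<le> (\<Sum>Z\<in>Pow (V - {u}). 2 * \<alpha>)"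
  proof (rule sum_mono)
    fix Z assume Z: "Z \<in> Pow (V - {u})"
    have "q dvd (\<Sum>j\<in>Z. M u j)" using Z M by (intro dvd_sum) auto
    then have "\<not> q dvd b u + (\<Sum>j\<in>Z. M u j)" using b by (simp add: dvd_add_left_iff)
    then have "\<not> int m dvd b u + (\<Sum>j\<in>Z. M u j)" using q dvd_trans by blast
    then show "cmod (e_char m (F Z) * (1 + e_char m (b u + (\<Sum>j\<in>Z. M u j)))) \<le> 2 * \<alpha>"
      using bound by (simp add: norm_mult)
  qed
  also have "\<dots> = 2 ^ card V * \<alpha>"
  proof -
    have "card V = Suc (card (V - {u}))" using u finite_V by (metis card.remove)
    then show ?thesis using finite_V by (simp add: card_Pow)
  qed
  finally show ?thesis .
qed

section \<open>Extending additive functions\<close>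

text \<open>This is the self-injectivity of the integers modulo \<open>q\<close>. Coordinates are
  added one at a time: if \<open>d\<close> is the least positive value of the new coordinate and
  \<open>s\<close> the defect of \<open>\<phi>\<close> at a vector attaining it, the new coefficient
  is \<open>s div d\<close>.\<close>

lemma additive_mod_extends:
  fixes K :: "('a \<Rightarrow> int) set" and \<phi> :: "('a \<Rightarrow> int) \<Rightarrow> int" and q :: int
  assumes q: "q > 0" and V: "finite V"
    and lin: "\<And>x y t. x \<in> K \<Longrightarrow> y \<in> K \<Longrightarrow>
       (\<lambda>i. x i - t * y i) \<in> K \<and> q dvd \<phi> (\<lambda>i. x i - t * y i) - (\<phi> x - t * \<phi> y)"
    and unit: "\<And>i. i \<in> V \<Longrightarrow> (\<lambda>j. if j = i then q else 0) \<in> K \<and> q dvd \<phi> (\<lambda>j. if j = i then q else 0)"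
  shows "\<exists>l. \<forall>z\<in>K. (\<forall>i. i \<notin> V \<longrightarrow> z i = 0) \<longrightarrow> q dvd \<phi> z - (\<Sum>i\<in>V. l i * z i)"
  using V unit
proof (induction V rule: finite_induct)
  case empty
  have "q dvd \<phi> z" if z: "z \<in> K" "\<forall>i. z i = 0" for z
  proof -
    \<comment> \<open>The choice \<open>x = y\<close>, \<open>t = 1\<close> in \<open>lin\<close>
      shows that \<open>\<phi>\<close> vanishes at zero modulo \<open>q\<close>.\<close>
    have "z = (\<lambda>i. 0)" using z(2) by auto
    then show ?thesis using lin[OF z(1) z(1), of 1] by simp
  qed
  then show ?case by (simp only: sum.empty diff_zero empty_iff not_False_eq_True simp_thms) blast
next
  case (insert i V)
  obtain l where "\<forall>z\<in>K. (\<forall>j. j \<notin> V \<longrightarrow> z j = 0) \<longrightarrow> q dvd \<phi> z - (\<Sum>j\<in>V. l j * z j)"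
    using insert.IH[OF insert.prems[OF insertI2]] by (rule exE)
  then have l: "q dvd \<phi> z - (\<Sum>j\<in>V. l j * z j)" if "z \<in> K" "\<And>j. j \<notin> V \<Longrightarrow> z j = 0" for z
    using that by blast
  let ?e = "\<lambda>j. if j = i then q else 0"
  have e: "?e \<in> K" "q dvd \<phi> ?e" using insert.prems[of i] by auto
  define S where "S = {z \<in> K. \<forall>j. j \<notin> insert i V \<longrightarrow> z j = 0}"
  have "\<exists>z. z \<in> S \<and> z i > 0" using e q by (intro exI[of _ ?e]) (auto simp: S_def)
  then obtain z0 where z0: "z0 \<in> S" "z0 i > 0"
    and min: "\<And>z. z \<in> S \<Longrightarrow> z i > 0 \<Longrightarrow> nat (z0 i) \<le> nat (z i)"
    using ex_has_least_nat[of "\<lambda>z. z \<in> S \<and> z i > 0" _ "\<lambda>z. nat (z i)"] by metis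
  define d where "d = z0 i"
  define s where "s = \<phi> z0 - (\<Sum>j\<in>V. l j * z0 j)"
  \<comment> \<open>Division with remainder by \<open>z0\<close> leaves a vector whose coordinate
    \<open>i\<close> is zero by minimality, so that the induction hypothesis applies to it.\<close>
  have red: "d dvd z i \<and> q dvd \<phi> z - (z i div d) * s - (\<Sum>j\<in>V. l j * z j)" if z: "z \<in> S" for z
  proof -
    define t where "t = z i div d"
    define y where "y j = z j - t * z0 j" for j
    have yK: "y \<in> K" "q dvd \<phi> y - (\<phi> z - t * \<phi> z0)"
      using lin[of z z0 t] z z0(1) by (auto simp: S_def y_def[abs_def])
    then have yS: "y \<in> S" using z z0(1) by (auto simp: S_def y_def)
    have yi: "y i = z i mod d" by (simp add: y_def t_def d_def minus_div_mult_eq_mod)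
    have "y i = 0"
    proof (rule ccontr)
      assume "y i \<noteq> 0"
      then have "y i > 0" using z0(2) yi d_def by (metis order_le_less pos_mod_sign)
      from min[OF yS this] have "d \<le> y i" using \<open>y i > 0\<close> by (simp add: d_def)
      then show False using yi z0(2) d_def pos_mod_bound[of d "z i"] by linarith
    qed
    then have "d dvd z i" using yi by auto
    have "q dvd \<phi> y - (\<Sum>j\<in>V. l j * y j)"
      using yS \<open>y i = 0\<close> by (intro l) (auto simp: S_def)
    then have "q dvd (\<phi> y - (\<Sum>j\<in>V. l j * y j)) - (\<phi> y - (\<phi> z - t * \<phi> z0))"
      using yK(2) by (rule dvd_diff)
    also have "(\<phi> y - (\<Sum>j\<in>V. l j * y j)) - (\<phi> y - (\<phi> z - t * \<phi> z0))
       = \<phi> z - t * s - (\<Sum>j\<in>V. l j * z j)"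
      by (simp add: y_def s_def algebra_simps sum_subtractf sum_distrib_left)
    finally show ?thesis using \<open>d dvd z i\<close> by (simp add: t_def)
  qed
  \<comment> \<open>That \<open>\<phi>\<close> vanishes modulo \<open>q\<close> on \<open>q\<close>
    times the unit vector is what makes \<open>s\<close> divisible by \<open>d\<close>.\<close>
  have eS: "?e \<in> S" using e by (auto simp: S_def)
  have dq: "d dvd q" and "q dvd \<phi> ?e - (q div d) * s - (\<Sum>j\<in>V. l j * ?e j)"
    using red[OF eS] by auto
  moreover have "(\<Sum>j\<in>V. l j * ?e j) = 0" using insert.hyps(2) by (intro sum.neutral) auto
  ultimately have "q dvd (q div d) * s" using e(2) by (simp add: dvd_diff_right_iff)
  then have "(q div d) * d dvd (q div d) * s" using dq by simp
  moreover have "q div d \<noteq> 0" using dvd_div_mult_self[OF dq] q by auto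
  ultimately have ds: "d dvd s" by simp
  define l' where "l' = l(i := s div d)"
  have "q dvd \<phi> z - (\<Sum>j\<in>insert i V. l' j * z j)" if z: "z \<in> S" for z
  proof -
    have "(\<Sum>j\<in>V. l' j * z j) = (\<Sum>j\<in>V. l j * z j)"
      using insert.hyps(2) by (intro sum.cong) (auto simp: l'_def)
    moreover have "(s div d) * z i = (z i div d) * s"
    proof -
      obtain s' z' where "s = d * s'" "z i = d * z'" using ds red[OF z] by (auto elim!: dvdE)
      then show ?thesis using z0(2) by (simp add: d_def)
    qed
    ultimately have "(\<Sum>j\<in>insert i V. l' j * z j) = (z i div d) * s + (\<Sum>j\<in>V. l j * z j)"
      using insert.hyps by (simp add: l'_def)
    then show ?thesis using red[OF z] by (simp add: algebra_simps)
  qed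
  then show ?case by (intro exI[of _ l']) (auto simp: S_def)
qed

section \<open>Upper bounds for the boolean rank\<close>

text \<open>A function that is constant modulo \<open>q\<close> on the fibres of the linear map
  factors through it. \<open>G\<close> evaluates \<open>f\<close> at a chosen point of the fibre;
  outside the image its value is an arbitrary residue.\<close>

lemma boolean_representableI:
  assumes q: "q > 1"
    and det: "\<And>x y. x \<in> boolean_cube n \<Longrightarrow> y \<in> boolean_cube n \<Longrightarrow>
       (\<And>j. j < r \<Longrightarrow> int q dvd (\<Sum>i<n. v j i * x i) - (\<Sum>i<n. v j i * y i)) \<Longrightarrow> int q dvd f x - f y"
  shows "boolean_representable q n f r"
proof -
  define w where "w j = (\<lambda>i\<in>{..<n}. v j i mod int q)" for j
  define \<Phi> where "\<Phi> x = (\<lambda>j\<in>{..<r}. (\<Sum>i<n. w j i * x i) mod int q)" for x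
  define G where "G u = f (SOME x. x \<in> boolean_cube n \<and> \<Phi> x = u) mod int q" for u
  have "(\<Sum>i<n. w j i * x i) mod int q = (\<Sum>i<n. v j i * x i) mod int q" for j x
  proof -
    have "(\<Sum>i<n. (w j i * x i) mod int q) = (\<Sum>i<n. (v j i * x i) mod int q)"
      by (rule sum.cong) (simp_all add: w_def mod_mult_left_eq)
    then show ?thesis
      using mod_sum_eq[where f = "\<lambda>i. w j i * x i" and A = "{..<n}" and a = "int q"]
        mod_sum_eq[where f = "\<lambda>i. v j i * x i" and A = "{..<n}" and a = "int q"] by simp
  qed
  then have \<Phi>: "\<Phi> x = (\<lambda>j\<in>{..<r}. (\<Sum>i<n. v j i * x i) mod int q)" for x
    by (simp add: \<Phi>_def)
  have "f x mod int q = G (\<Phi> x)" if x: "x \<in> boolean_cube n" for x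
  proof -
    define y where "y = (SOME y. y \<in> boolean_cube n \<and> \<Phi> y = \<Phi> x)"
    have y: "y \<in> boolean_cube n \<and> \<Phi> y = \<Phi> x"
      unfolding y_def by (rule someI[of _ x]) (use x in simp)
    have "int q dvd (\<Sum>i<n. v j i * x i) - (\<Sum>i<n. v j i * y i)" if "j < r" for j
      using fun_cong[OF conjunct2[OF y], of j] that by (simp add: \<Phi> mod_eq_dvd_iff[symmetric])
    then have "int q dvd f x - f y" using x y by (intro det) auto
    then show ?thesis by (simp add: G_def y_def mod_eq_dvd_iff)
  qed
  moreover have "G \<in> ({..<r} \<rightarrow>\<^sub>E Zmod q) \<rightarrow> Zmod q" using q by (auto simp: G_def Zmod_def)
  moreover have "w \<in> {..<r} \<rightarrow> ({..<n} \<rightarrow>\<^sub>E Zmod q)" using q by (auto simp: w_def Zmod_def)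
  ultimately show ?thesis unfolding boolean_representable_def \<Phi>_def by blast
qed

lemma boolean_rank_le_card:
  fixes \<V> :: "(nat \<Rightarrow> int) set"
  assumes q: "q > 1" and fin: "finite \<V>"
    and det: "\<And>x y. x \<in> boolean_cube n \<Longrightarrow> y \<in> boolean_cube n \<Longrightarrow>
       (\<And>v. v \<in> \<V> \<Longrightarrow> int q dvd (\<Sum>i<n. v i * x i) - (\<Sum>i<n. v i * y i)) \<Longrightarrow> int q dvd f x - f y"
  shows "boolean_rank q n f \<le> card \<V>"
proof -
  obtain v where v: "bij_betw v {..<card \<V>} \<V>"
    using ex_bij_betw_nat_finite[OF fin] by (auto simp: atLeast0LessThan)
  have "boolean_representable q n f (card \<V>)"
  proof (rule boolean_representableI[OF q])
    fix x y assume xy: "x \<in> boolean_cube n" "y \<in> boolean_cube n"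
      and j: "\<And>j. j < card \<V> \<Longrightarrow> int q dvd (\<Sum>i<n. v j i * x i) - (\<Sum>i<n. v j i * y i)"
    show "int q dvd f x - f y"
    proof (rule det[OF xy])
      fix u assume "u \<in> \<V>"
      then obtain j where "j < card \<V>" "u = v j" using v by (auto simp: bij_betw_def)
      then show "int q dvd (\<Sum>i<n. u i * x i) - (\<Sum>i<n. u i * y i)" using j by simp
    qed
  qed
  then show ?thesis unfolding boolean_rank_def by (rule Least_le)
qed

section \<open>Quadratic functions determined by few linear forms\<close>

lemma sum_eq_sum_of_bool:
  fixes f :: "'a \<Rightarrow> int"
  assumes "finite V" "X \<subseteq> V"
  shows "(\<Sum>i\<in>X. f i) = (\<Sum>i\<in>V. f i * of_bool (i \<in> X))"
  using assms by (intro sum.mono_neutral_cong_left) auto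

lemma even_symmetric_form:
  fixes M :: "'a \<Rightarrow> 'a \<Rightarrow> int"
  assumes "finite S" "\<And>i j. M i j = M j i" "\<And>i. M i i = 0"
  shows "even (\<Sum>u\<in>S. \<Sum>v\<in>S. M u v * z u * z v)"
  using assms(1)
proof (induction S rule: finite_induct)
  case (insert s S)
  have "(\<Sum>v\<in>S. M s v * z s * z v) = (\<Sum>v\<in>S. M v s * z v * z s)"
    by (simp add: assms(2)[of s] mult_ac)
  then show ?case using insert assms(3) by (simp add: sum.distrib)
qed simp

context cube_quadratic
begin

definition row :: "('a \<Rightarrow> int) \<Rightarrow> 'a \<Rightarrow> int" where
  "row z u = (\<Sum>v\<in>V. M u v * z v)"

lemma row_diff: "row (\<lambda>i. x i - t * y i) u = row x u - t * row y u"
  by (simp add: row_def algebra_simps sum_subtractf sum_distrib_left)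

lemma sum_row_swap: "(\<Sum>u\<in>V. x u * row y u) = (\<Sum>u\<in>V. y u * row x u)"
proof -
  have "(\<Sum>u\<in>V. x u * row y u) = (\<Sum>u\<in>V. \<Sum>v\<in>V. x u * (M u v * y v))"
    by (simp add: row_def sum_distrib_left)
  also have "\<dots> = (\<Sum>v\<in>V. \<Sum>u\<in>V. x u * (M u v * y v))"
    by (rule sum.swap)
  also have "\<dots> = (\<Sum>v\<in>V. y v * row x v)"
    by (simp add: row_def sum_distrib_left sym mult_ac)
  finally show ?thesis .
qed

lemma even_sum_row: "even (\<Sum>u\<in>V. z u * row z u)"
  using even_symmetric_form[of V M z, OF finite_V sym diag]
  by (simp add: row_def sum_distrib_left mult_ac)

text \<open>The quadratic term is \<open>x^T M x - y^T M y = (x + y)^T M (x - y)\<close> for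
  symmetric \<open>M\<close>, with \<open>x + y\<close> written as \<open>2 * x - z\<close>.\<close>

lemma F_diff:
  assumes "X \<subseteq> V" "Y \<subseteq> V"
  defines "x \<equiv> \<lambda>i. of_bool (i \<in> X)" and "z \<equiv> \<lambda>i. of_bool (i \<in> X) - of_bool (i \<in> Y)"
  shows "2 * (F X - F Y) = 2 * (\<Sum>i\<in>V. b i * z i) + (\<Sum>u\<in>V. (2 * x u - z u) * row z u)"
proof -
  define y where "y i = (of_bool (i \<in> Y) :: int)" for i
  have q: "(\<Sum>i\<in>Z. \<Sum>j\<in>Z. M i j) = (\<Sum>u\<in>V. of_bool (u \<in> Z) * row (\<lambda>i. of_bool (i \<in> Z)) u)"
    if "Z \<subseteq> V" for Z
    using that by (simp add: sum_eq_sum_of_bool[OF finite_V that] row_def mult_ac)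
  have z: "z = (\<lambda>i. x i - 1 * y i)" by (simp add: z_def x_def y_def fun_eq_iff)
  have "2 * F X = 2 * c + 2 * (\<Sum>i\<in>V. b i * x i) + (\<Sum>u\<in>V. x u * row x u)"
    using F[OF assms(1)] q[OF assms(1)] sum_eq_sum_of_bool[OF finite_V assms(1), of b] by (simp add: x_def)
  moreover have "2 * F Y = 2 * c + 2 * (\<Sum>i\<in>V. b i * y i) + (\<Sum>u\<in>V. y u * row y u)"
    using F[OF assms(2)] q[OF assms(2)] sum_eq_sum_of_bool[OF finite_V assms(2), of b]
    by (simp add: y_def[abs_def])
  moreover have "(\<Sum>i\<in>V. b i * z i) = (\<Sum>i\<in>V. b i * x i) - (\<Sum>i\<in>V. b i * y i)"
    by (simp add: z algebra_simps sum_subtractf)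
  moreover have "(\<Sum>u\<in>V. (2 * x u - z u) * row z u) = (\<Sum>u\<in>V. x u * row x u) - (\<Sum>u\<in>V. y u * row y u)"
  proof -
    have "(2 * x u - z u) * row z u = x u * row x u - y u * row y u + (y u * row x u - x u * row y u)" for u
      unfolding z row_diff by (simp add: algebra_simps)
    then have "(\<Sum>u\<in>V. (2 * x u - z u) * row z u)
       = (\<Sum>u\<in>V. x u * row x u) - (\<Sum>u\<in>V. y u * row y u)
         + ((\<Sum>u\<in>V. y u * row x u) - (\<Sum>u\<in>V. x u * row y u))"
      by (simp add: sum.distrib sum_subtractf)
    then show ?thesis using sum_row_swap[of x y] by simp
  qed
  ultimately show ?thesis by simp
qed

text \<open>Outside \<open>A \<union> B\<close> the matrix \<open>M\<close> agrees modulo \<open>q\<close> with a matrix of low rank, except on the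
  diagonal; \<open>g\<close> is that diagonal.\<close>

lemma row_plus_diagonal:
  assumes AB: "A \<subseteq> V" "B \<subseteq> V"
    and L: "\<forall>u\<in>V - A - B. \<forall>v\<in>V - A - B. u \<noteq> v \<longrightarrow> q dvd M u v - (\<Sum>a\<in>A. L u a * M a v)"
    and z: "\<And>i. i \<in> A \<union> B \<Longrightarrow> z i = 0" and row: "\<And>i. i \<in> A \<union> B \<Longrightarrow> q dvd row z i"
    and u: "u \<in> V"
  defines "g \<equiv> \<lambda>u. if u \<in> A \<union> B then 0 else (\<Sum>a\<in>A. L u a * M a u)"
  shows "q dvd row z u + g u * z u"
proof (cases "u \<in> A \<union> B")
  case True
  then show ?thesis using row[of u] by (simp add: g_def)
next
  case False
  \<comment> \<open>Each summand vanishes modulo \<open>q\<close>: \<open>z\<close> is zero on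
    \<open>A \<union> B\<close>, \<open>g\<close> corrects the diagonal, and \<open>L\<close>
    handles the rest.\<close>
  have "q dvd (\<Sum>v\<in>V. (M u v - (\<Sum>a\<in>A. L u a * M a v) + (if v = u then g u else 0)) * z v)"
  proof (rule dvd_sum)
    fix v assume v: "v \<in> V"
    consider "v \<in> A \<union> B" | "v = u" | "v \<in> V - A - B" "v \<noteq> u" using v by blast
    then show "q dvd (M u v - (\<Sum>a\<in>A. L u a * M a v) + (if v = u then g u else 0)) * z v"
    proof cases
      case 1 then show ?thesis using z by simp
    next
      case 2 then show ?thesis using False by (simp add: g_def diag)
    next
      case 3 then show ?thesis using L u False by auto
    qed
  qed
  also have "(\<Sum>v\<in>V. (M u v - (\<Sum>a\<in>A. L u a * M a v) + (if v = u then g u else 0)) * z v)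
     = row z u - (\<Sum>v\<in>V. \<Sum>a\<in>A. L u a * M a v * z v) + (\<Sum>v\<in>V. if v = u then g u * z v else 0)"
  proof -
    have "(M u v - (\<Sum>a\<in>A. L u a * M a v) + (if v = u then g u else 0)) * z v
       = M u v * z v - (\<Sum>a\<in>A. L u a * M a v * z v) + (if v = u then g u * z v else 0)" for v
      by (simp add: distrib_right left_diff_distrib sum_distrib_right)
    then show ?thesis by (simp only: row_def sum.distrib sum_subtractf)
  qed
  also have "(\<Sum>v\<in>V. \<Sum>a\<in>A. L u a * M a v * z v) = (\<Sum>a\<in>A. L u a * row z a)"
    by (subst sum.swap) (simp add: row_def sum_distrib_left mult.assoc)
  also have "(\<Sum>v\<in>V. if v = u then g u * z v else 0) = g u * z u"
    using u finite_V by simp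
  finally have "q dvd row z u - (\<Sum>a\<in>A. L u a * row z a) + g u * z u" .
  moreover have "q dvd (\<Sum>a\<in>A. L u a * row z a)" using row by (intro dvd_sum[of A] dvd_mult) auto
  ultimately have "q dvd (row z u - (\<Sum>a\<in>A. L u a * row z a) + g u * z u) + (\<Sum>a\<in>A. L u a * row z a)"
    by (rule dvd_add)
  then show ?thesis by (simp add: algebra_simps)
qed

text \<open>For the difference \<open>z\<close> of the indicators this supplies the hypotheses of
  \<open>row_plus_diagonal\<close>. The set \<open>T\<close> is separate from \<open>S\<close>
  because the even case also fixes the rows in \<open>I\<close>, but not those coordinates.\<close>

definition agree :: "int \<Rightarrow> 'a set \<Rightarrow> 'a set \<Rightarrow> 'a set \<Rightarrow> 'a set \<Rightarrow> bool" where
  "agree q S T X Y \<longleftrightarrow> X \<inter> S = Y \<inter> S \<and>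
     (\<forall>i\<in>T. q dvd row (\<lambda>j. of_bool (j \<in> X) - of_bool (j \<in> Y)) i)"

text \<open>This is \<open>(x + y) * (x - y) = x^2 - y^2 = x - y\<close> for bits; it makes a
  diagonal quadratic term linear.\<close>

lemma of_bool_diff_absorb:
  fixes X Y i
  defines "x \<equiv> (of_bool (i \<in> X) :: int)" and "z \<equiv> of_bool (i \<in> X) - (of_bool (i \<in> Y) :: int)"
  shows "(2 * x - z) * z = z"
  by (auto simp: x_def z_def)

text \<open>For agreeing points \<open>row z\<close> is \<open>- g * z\<close> modulo
  \<open>q\<close>, so the quadratic term becomes linear by \<open>of_bool_diff_absorb\<close>. The
  form \<open>2 * b - g\<close> then determines \<open>2 * (F X - F Y)\<close>, and 2 is invertible
  modulo \<open>q\<close>.\<close>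

lemma F_determined_odd:
  assumes q: "odd q" and AB: "A \<subseteq> V" "B \<subseteq> V"
    and L: "\<forall>u\<in>V - A - B. \<forall>v\<in>V - A - B. u \<noteq> v \<longrightarrow> q dvd M u v - (\<Sum>a\<in>A. L u a * M a v)"
  shows "\<exists>l. \<forall>X Y. X \<subseteq> V \<longrightarrow> Y \<subseteq> V \<longrightarrow> agree q (A \<union> B) (A \<union> B) X Y \<longrightarrow>
     q dvd (\<Sum>i\<in>V. l i * (of_bool (i \<in> X) - of_bool (i \<in> Y))) \<longrightarrow> q dvd F X - F Y"
proof -
  define g where "g u = (if u \<in> A \<union> B then 0 else (\<Sum>a\<in>A. L u a * M a u))" for u
  have "q dvd F X - F Y" if XY: "X \<subseteq> V" "Y \<subseteq> V" and ag: "agree q (A \<union> B) (A \<union> B) X Y"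
    and l: "q dvd (\<Sum>i\<in>V. (2 * b i - g i) * (of_bool (i \<in> X) - of_bool (i \<in> Y)))" for X Y
  proof -
    define x where "x i = (of_bool (i \<in> X) :: int)" for i
    define z where "z i = (of_bool (i \<in> X) - of_bool (i \<in> Y) :: int)" for i
    have N: "q dvd row z u + g u * z u" if "u \<in> V" for u
      unfolding g_def using ag by (intro row_plus_diagonal AB L that) (auto simp: agree_def z_def[abs_def])
    have "2 * (F X - F Y) = 2 * (\<Sum>i\<in>V. b i * z i) + (\<Sum>u\<in>V. (2 * x u - z u) * row z u)"
      using F_diff[OF XY] by (simp add: x_def z_def[abs_def])
    also have "\<dots> = (\<Sum>i\<in>V. 2 * (b i * z i) + (2 * x i - z i) * row z i)"
      by (simp add: sum.distrib sum_distrib_left)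
    also have "\<dots> = (\<Sum>i\<in>V. (2 * b i - g i) * z i + (2 * x i - z i) * (row z i + g i * z i))"
    proof (rule sum.cong[OF refl])
      fix i
      have "g i * ((2 * x i - z i) * z i) = g i * z i"
        unfolding x_def z_def of_bool_diff_absorb ..
      then show "2 * (b i * z i) + (2 * x i - z i) * row z i
        = (2 * b i - g i) * z i + (2 * x i - z i) * (row z i + g i * z i)"
        by (simp add: algebra_simps)
    qed
    also have "\<dots> = (\<Sum>i\<in>V. (2 * b i - g i) * z i) + (\<Sum>i\<in>V. (2 * x i - z i) * (row z i + g i * z i))"
      by (rule sum.distrib)
    finally have eq: "2 * (F X - F Y)
       = (\<Sum>i\<in>V. (2 * b i - g i) * z i) + (\<Sum>i\<in>V. (2 * x i - z i) * (row z i + g i * z i))" .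
    have "q dvd (\<Sum>i\<in>V. (2 * b i - g i) * z i)" using l by (simp add: z_def)
    moreover have "q dvd (\<Sum>i\<in>V. (2 * x i - z i) * (row z i + g i * z i))"
      using N by (intro dvd_sum[of V] dvd_mult)
    ultimately have "q dvd 2 * (F X - F Y)" unfolding eq by (rule dvd_add)
    moreover have "coprime q 2" using q by simp
    ultimately show ?thesis using coprime_dvd_mult_right_iff by blast
  qed
  then show ?thesis by (intro exI[of _ "\<lambda>i. 2 * b i - g i"] allI impI)
qed

text \<open>Halving now loses information modulo \<open>q\<close>. Fixing the rows in
  \<open>I\<close> makes every \<open>g u * z u\<close> even, so the diagonal part can be halved
  exactly. What remains is \<open>\<phi>\<close>, which is additive modulo \<open>q\<close> on the
  subgroup \<open>K\<close> and is replaced by a linear form.\<close>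

lemma F_determined_even:
  assumes q: "even q" "q > 0" and AB: "A \<subseteq> V" "B \<subseteq> V"
    and L: "\<forall>u\<in>V - A - B. \<forall>v\<in>V - A - B. u \<noteq> v \<longrightarrow> q dvd M u v - (\<Sum>a\<in>A. L u a * M a v)"
    and I: "\<And>z u. (\<And>i. i \<in> I \<Longrightarrow> even (row z i)) \<Longrightarrow> u \<in> V \<Longrightarrow> even (row z u)"
  shows "\<exists>l. \<forall>X Y. X \<subseteq> V \<longrightarrow> Y \<subseteq> V \<longrightarrow> agree q (A \<union> B) (A \<union> B \<union> I) X Y \<longrightarrow>
     q dvd (\<Sum>i\<in>V. l i * (of_bool (i \<in> X) - of_bool (i \<in> Y))) \<longrightarrow> q dvd F X - F Y"
proof -
  define g where "g u = (if u \<in> A \<union> B then 0 else (\<Sum>a\<in>A. L u a * M a u))" for u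
  define N where "N z u = row z u + g u * z u" for z u
  define \<phi> where "\<phi> z = (\<Sum>u\<in>V. z u * N z u) div 2" for z
  define K where "K = {z. \<forall>u\<in>V. q dvd N z u \<and> even (g u * z u)}"
  have N_diff: "N (\<lambda>i. x i - t * y i) u = N x u - t * N y u" for x y t u
    by (simp add: N_def row_diff algebra_simps)
  have N_swap: "(\<Sum>u\<in>V. x u * N y u) = (\<Sum>u\<in>V. y u * N x u)" for x y
    by (simp add: N_def algebra_simps sum.distrib sum_row_swap[of x y])
  have \<phi>2: "2 * \<phi> z = (\<Sum>u\<in>V. z u * N z u)" if "z \<in> K" for z
  proof -
    have "(\<Sum>u\<in>V. z u * N z u) = (\<Sum>u\<in>V. z u * row z u) + (\<Sum>u\<in>V. z u * (g u * z u))"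
      by (simp add: N_def algebra_simps sum.distrib)
    moreover have "even (\<Sum>u\<in>V. z u * (g u * z u))"
      using that unfolding K_def by (intro dvd_sum[of V] dvd_mult[of 2 "g _ * z _"]) blast
    ultimately have "even (\<Sum>u\<in>V. z u * N z u)" using even_sum_row[of z] by simp
    then show ?thesis by (simp add: \<phi>_def)
  qed
  have q2\<phi>: "q dvd 2 * \<phi> z" if "z \<in> K" for z
    unfolding \<phi>2[OF that] using that by (intro dvd_sum[of V] dvd_mult) (simp add: K_def)
  have lin: "(\<lambda>i. x i - t * y i) \<in> K \<and> q dvd \<phi> (\<lambda>i. x i - t * y i) - (\<phi> x - t * \<phi> y)"
    if x: "x \<in> K" and y: "y \<in> K" for x y t
  proof
    let ?z = "\<lambda>i. x i - t * y i"
    have "q dvd N ?z u" "even (g u * ?z u)" if "u \<in> V" for u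
    proof -
      have "q dvd N x u" "q dvd N y u" "even (g u * x u)" "even (g u * y u)"
        using x y that by (auto simp: K_def)
      then show "q dvd N ?z u" "even (g u * ?z u)"
        unfolding N_diff by (auto intro: dvd_diff dvd_mult)
    qed
    then show K: "?z \<in> K" by (simp add: K_def)
    have "2 * \<phi> ?z = (\<Sum>u\<in>V. x u * N x u) - t * (\<Sum>u\<in>V. x u * N y u) - t * (\<Sum>u\<in>V. y u * N x u)
        + t * t * (\<Sum>u\<in>V. y u * N y u)"
      unfolding \<phi>2[OF K] N_diff by (simp add: algebra_simps sum.distrib sum_subtractf sum_distrib_left)
    also have "\<dots> = 2 * (\<phi> x - t * (\<Sum>u\<in>V. x u * N y u) + t * t * \<phi> y)"
      using N_swap[of x y] by (simp add: algebra_simps flip: \<phi>2[OF x] \<phi>2[OF y])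
    finally have "\<phi> ?z = \<phi> x - t * (\<Sum>u\<in>V. x u * N y u) + t * t * \<phi> y" by simp
    then have eq: "\<phi> ?z - (\<phi> x - t * \<phi> y) = (t * (t + 1)) * \<phi> y - t * (\<Sum>u\<in>V. x u * N y u)"
      by (simp add: algebra_simps)
    \<comment> \<open>The quadratic \<open>t * t\<close> has to act as \<open>- t\<close>; the
      discrepancy is even, and \<open>2 * \<phi> y\<close> is divisible by \<open>q\<close>.\<close>
    have "even (t * (t + 1))" by simp
    then obtain s where "t * (t + 1) = 2 * s" by blast
    then have "q dvd (t * (t + 1)) * \<phi> y"
      using q2\<phi>[OF y] by (metis dvd_mult mult.assoc mult.commute)
    moreover have "q dvd (\<Sum>u\<in>V. x u * N y u)" using y by (intro dvd_sum[of V] dvd_mult) (auto simp: K_def)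
    ultimately show "q dvd \<phi> ?z - (\<phi> x - t * \<phi> y)" unfolding eq by (intro dvd_diff) (auto intro: dvd_mult)
  qed
  have unit: "(\<lambda>j. if j = i then q else 0) \<in> K \<and> q dvd \<phi> (\<lambda>j. if j = i then q else 0)" if i: "i \<in> V" for i
  proof
    let ?e = "\<lambda>j. if j = i then q else 0"
    have "row ?e u = M u i * q" for u
    proof -
      have "row ?e u = (\<Sum>v\<in>V. if v = i then M u i * q else 0)" unfolding row_def by (intro sum.cong) auto
      then show ?thesis using i finite_V by simp
    qed
    then have N: "N ?e u = M u i * q + (if u = i then g u * q else 0)" for u by (simp add: N_def)
    then show K: "?e \<in> K" using q by (auto simp: K_def)
    have "2 * \<phi> ?e = (\<Sum>u\<in>V. if u = i then q * (g i * q) else 0)"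
      unfolding \<phi>2[OF K] by (intro sum.cong) (auto simp: N diag)
    also have "\<dots> = q * (g i * q)" using i finite_V by simp
    \<comment> \<open>Since \<open>q\<close> is even, one of the two factors \<open>q\<close> can be
      halved while the other survives.\<close>
    finally have "2 * \<phi> ?e = 2 * (q * (g i * (q div 2)))" using q(1) by (auto elim!: evenE)
    then show "q dvd \<phi> ?e" by simp
  qed
  obtain l where l: "\<forall>z\<in>K. (\<forall>i. i \<notin> V \<longrightarrow> z i = 0) \<longrightarrow> q dvd \<phi> z - (\<Sum>i\<in>V. l i * z i)"
    using additive_mod_extends[of q V K \<phi>, OF q(2) finite_V lin unit] by blast
  define l' where "l' i = b i - g i div 2 - l i" for i
  have "q dvd F X - F Y" if XY: "X \<subseteq> V" "Y \<subseteq> V" and ag: "agree q (A \<union> B) (A \<union> B \<union> I) X Y"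
    and l': "q dvd (\<Sum>i\<in>V. l' i * (of_bool (i \<in> X) - of_bool (i \<in> Y)))" for X Y
  proof -
    define x where "x i = (of_bool (i \<in> X) :: int)" for i
    define z where "z i = (of_bool (i \<in> X) - of_bool (i \<in> Y) :: int)" for i
    have N: "q dvd N z u" if "u \<in> V" for u
      unfolding g_def N_def using ag
      by (intro row_plus_diagonal AB L that) (auto simp: agree_def z_def[abs_def])
    have even_g: "even (g u * z u)" if u: "u \<in> V" for u
    proof -
      have "even (row z i)" if "i \<in> I" for i
        using ag that q(1) by (auto simp: agree_def z_def[abs_def] intro: dvd_trans)
      then have "even (row z u)" using I u by blast
      moreover have "even (N z u)" using N[OF u] q(1) dvd_trans by blast
      ultimately show ?thesis by (simp add: N_def)
    qed
    have zK: "z \<in> K" using N even_g by (auto simp: K_def)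
    have supp: "\<forall>i. i \<notin> V \<longrightarrow> z i = 0" using XY by (auto simp: z_def)
    have "2 * (F X - F Y) = 2 * (\<Sum>i\<in>V. b i * z i) + (\<Sum>u\<in>V. (2 * x u - z u) * row z u)"
      using F_diff[OF XY] by (simp add: x_def z_def[abs_def])
    also have "\<dots> = (\<Sum>i\<in>V. 2 * (b i * z i) + (2 * x i - z i) * row z i)"
      by (simp add: sum.distrib sum_distrib_left)
    also have "\<dots> = (\<Sum>i\<in>V. 2 * ((b i - g i div 2) * z i) + 2 * (x i * N z i) - z i * N z i)"
    proof (rule sum.cong[OF refl])
      fix i assume i: "i \<in> V"
      have "g i * ((2 * x i - z i) * z i) = g i * z i"
        unfolding x_def z_def of_bool_diff_absorb ..
      \<comment> \<open>If \<open>g i\<close> is odd, evenness of \<open>g i * z i\<close> forces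
        \<open>z i = 0\<close>, so the rounding in \<open>g i div 2\<close> does no harm.\<close>
      moreover have "g i * z i = 2 * (g i div 2 * z i)"
        using even_g[OF i] by (cases "even (g i)") (auto simp: z_def of_bool_def split: if_splits)
      ultimately show "2 * (b i * z i) + (2 * x i - z i) * row z i
        = 2 * ((b i - g i div 2) * z i) + 2 * (x i * N z i) - z i * N z i"
        by (simp add: N_def algebra_simps)
    qed
    also have "\<dots> = 2 * (\<Sum>i\<in>V. (b i - g i div 2) * z i) + 2 * (\<Sum>i\<in>V. x i * N z i) - 2 * \<phi> z"
      unfolding \<phi>2[OF zK] by (simp only: sum.distrib sum_subtractf sum_distrib_left)
    finally have "F X - F Y = (\<Sum>i\<in>V. (b i - g i div 2) * z i) + (\<Sum>i\<in>V. x i * N z i) - \<phi> z" by simp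
    also have "\<dots> = (\<Sum>i\<in>V. l' i * z i) + (\<Sum>i\<in>V. x i * N z i) - (\<phi> z - (\<Sum>i\<in>V. l i * z i))"
      by (simp add: l'_def algebra_simps sum.distrib sum_subtractf)
    finally have eq: "F X - F Y = (\<Sum>i\<in>V. l' i * z i) + (\<Sum>i\<in>V. x i * N z i) - (\<phi> z - (\<Sum>i\<in>V. l i * z i))" .
    have "q dvd (\<Sum>i\<in>V. l' i * z i)" using l' by (simp add: z_def)
    moreover have "q dvd (\<Sum>i\<in>V. x i * N z i)" using N by (intro dvd_sum[of V] dvd_mult)
    moreover have "q dvd \<phi> z - (\<Sum>i\<in>V. l i * z i)" using l zK supp by blast
    ultimately show ?thesis unfolding eq by (rule dvd_diff[OF dvd_add])
  qed
  then show ?thesis by (intro exI[of _ l'] allI impI)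
qed

end

section \<open>Quadratic polynomials on the cube\<close>

text \<open>For two variables, \<open>M\<close> places the product in both orders, which matches the
  doubled left side.\<close>

lemma subset_indicator_quadratic:
  fixes T :: "'a set"
  assumes "finite T" "card T \<le> 2"
  shows "\<exists>(c::int) b M. (\<forall>i j. M i j = M j i) \<and> (\<forall>i. M i i = 0) \<and>
     (\<forall>X. finite X \<longrightarrow> 2 * of_bool (T \<subseteq> X) = 2 * c + 2 * (\<Sum>i\<in>X. b i) + (\<Sum>i\<in>X. \<Sum>j\<in>X. M i j))"
proof -
  have ind: "(\<Sum>i\<in>X. of_bool (i = s) :: int) = of_bool (s \<in> X)" if "finite X" for X and s :: 'a
    using that by (simp add: of_bool_def)
  consider "card T = 0" | "card T = 1" | "card T = 2" using assms(2) by linarith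
  then show ?thesis
  proof cases
    case 1
    then show ?thesis using assms(1)
      by (intro exI[of _ 1] exI[of _ "\<lambda>_. 0"] exI[of _ "\<lambda>_ _. 0"]) simp
  next
    case 2
    then obtain s where "T = {s}" by (auto simp: card_1_singleton_iff)
    then show ?thesis
      by (intro exI[of _ 0] exI[of _ "\<lambda>i. of_bool (i = s)"] exI[of _ "\<lambda>_ _. 0"]) (simp add: ind)
  next
    case 3
    then obtain s t where st: "T = {s, t}" "s \<noteq> t" by (auto simp: card_2_iff)
    let ?M = "\<lambda>i j. of_bool (i = s) * of_bool (j = t) + of_bool (i = t) * of_bool (j = s) :: int"
    have "(\<Sum>i\<in>X. \<Sum>j\<in>X. ?M i j) = 2 * of_bool (T \<subseteq> X)" if "finite X" for X
      by (simp add: sum.distrib ind[OF that] st of_bool_conj mult.commute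
          flip: sum_distrib_left sum_distrib_right)
    then show ?thesis using st(2)
      by (intro exI[of _ 0] exI[of _ "\<lambda>_. 0"] exI[of _ ?M]) auto
  qed
qed

lemma card_keys_le_monomial_degree: "card (Poly_Mapping.keys t) \<le> monomial_degree t"
proof -
  have "(\<Sum>i\<in>Poly_Mapping.keys t. 1) \<le> (\<Sum>i\<in>Poly_Mapping.keys t. Poly_Mapping.lookup t i)"
    by (intro sum_mono) (simp add: in_keys_iff Suc_le_eq)
  then show ?thesis by (simp add: monomial_degree_def)
qed

text \<open>At 0/1 points positive exponents are invisible, so a monomial enters only through its
  set of variables.\<close>

definition set_eval :: "polynomial \<Rightarrow> nat set \<Rightarrow> int" where
  "set_eval f X = (\<Sum>t\<in>Poly_Mapping.keys f. Poly_Mapping.lookup f t * of_bool (Poly_Mapping.keys t \<subseteq> X))"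

lemma poly_eval_boolean:
  assumes f: "\<And>t. t \<in> Poly_Mapping.keys f \<Longrightarrow> Poly_Mapping.keys t \<subseteq> {..<n}"
    and x: "x \<in> boolean_cube n"
  shows "poly_eval f x = set_eval f {i. i < n \<and> x i = 1}"
  unfolding poly_eval_def set_eval_def
proof (rule sum.cong[OF refl])
  fix t assume t: "t \<in> Poly_Mapping.keys f"
  have "(\<Prod>i\<in>Poly_Mapping.keys t. x i ^ Poly_Mapping.lookup t i)
     = (\<Prod>i\<in>Poly_Mapping.keys t. of_bool (x i = 1))"
  proof (rule prod.cong[OF refl])
    fix i assume i: "i \<in> Poly_Mapping.keys t"
    then have "x i = 0 \<or> x i = 1" using f[OF t] x by (auto simp: boolean_cube_def)
    then show "x i ^ Poly_Mapping.lookup t i = of_bool (x i = 1)" using i by (auto simp: in_keys_iff)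
  qed
  also have "\<dots> = of_bool (\<forall>i\<in>Poly_Mapping.keys t. x i = 1)"
    using finite_keys[of t] by (induction rule: finite_induct) auto
  also have "\<dots> = of_bool (Poly_Mapping.keys t \<subseteq> {i. i < n \<and> x i = 1})"
    using f[OF t] by (auto simp: subset_iff)
  finally show "Poly_Mapping.lookup f t * (\<Prod>i\<in>Poly_Mapping.keys t. x i ^ Poly_Mapping.lookup t i)
     = Poly_Mapping.lookup f t * of_bool (Poly_Mapping.keys t \<subseteq> {i. i < n \<and> x i = 1})" by simp
qed

lemma set_eval_quadratic:
  assumes "degree_le f 2"
  shows "\<exists>c b M. cube_quadratic {..<n} c b M (set_eval f)"
proof -
  let ?k = Poly_Mapping.keys
  have "\<forall>t\<in>?k f. \<exists>cbM. case cbM of (c :: int, b, M) \<Rightarrow> (\<forall>i j. M i j = M j i) \<and> (\<forall>i. M i i = 0) \<and>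
     (\<forall>X. finite X \<longrightarrow> 2 * of_bool (?k t \<subseteq> X) = 2 * c + 2 * (\<Sum>i\<in>X. b i) + (\<Sum>i\<in>X. \<Sum>j\<in>X. M i j))"
  proof
    fix t assume "t \<in> ?k f"
    then have "card (?k t) \<le> 2"
      using assms card_keys_le_monomial_degree[of t] by (auto simp: degree_le_def)
    from subset_indicator_quadratic[OF finite_keys this]
    show "\<exists>cbM. case cbM of (c :: int, b, M) \<Rightarrow> (\<forall>i j. M i j = M j i) \<and> (\<forall>i. M i i = 0) \<and>
     (\<forall>X. finite X \<longrightarrow> 2 * of_bool (?k t \<subseteq> X) = 2 * c + 2 * (\<Sum>i\<in>X. b i) + (\<Sum>i\<in>X. \<Sum>j\<in>X. M i j))"
      by simp
  qed
  from bchoice[OF this] obtain h where h: "\<forall>t\<in>?k f. case h t of (c :: int, b, M) \<Rightarrow> (\<forall>i j. M i j = M j i) \<and> (\<forall>i. M i i = 0) \<and>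
     (\<forall>X. finite X \<longrightarrow> 2 * of_bool (?k t \<subseteq> X) = 2 * c + 2 * (\<Sum>i\<in>X. b i) + (\<Sum>i\<in>X. \<Sum>j\<in>X. M i j))"
    by (rule exE)
  define c where "c t = fst (h t)" for t
  define b where "b t = fst (snd (h t))" for t
  define M where "M t = snd (snd (h t))" for t
  have sym: "M t i j = M t j i" and diag: "M t i i = 0"
    and eq: "finite X \<Longrightarrow> 2 * of_bool (?k t \<subseteq> X) = 2 * c t + 2 * (\<Sum>i\<in>X. b t i) + (\<Sum>i\<in>X. \<Sum>j\<in>X. M t i j)"
    if "t \<in> ?k f" for t i j X
    using bspec[OF h that] by (auto simp: c_def b_def M_def split_beta)
  define w where "w t = Poly_Mapping.lookup f t" for t
  have "cube_quadratic {..<n} (\<Sum>t\<in>?k f. w t * c t) (\<lambda>i. \<Sum>t\<in>?k f. w t * b t i)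
     (\<lambda>i j. \<Sum>t\<in>?k f. w t * M t i j) (set_eval f)"
  proof
    fix i j
    show "(\<Sum>t\<in>?k f. w t * M t i j) = (\<Sum>t\<in>?k f. w t * M t j i)"
      using sym by (intro sum.cong) auto
    show "(\<Sum>t\<in>?k f. w t * M t i i) = 0" using diag by (intro sum.neutral) auto
  next
    fix X assume "X \<subseteq> {..<n}"
    then have X: "finite X" using finite_subset by blast
    have "2 * set_eval f X = (\<Sum>t\<in>?k f. w t * (2 * of_bool (?k t \<subseteq> X)))"
      unfolding set_eval_def w_def sum_distrib_left by (rule sum.cong) (simp_all only: mult.left_commute)
    also have "\<dots> = (\<Sum>t\<in>?k f. w t * (2 * c t + 2 * (\<Sum>i\<in>X. b t i) + (\<Sum>i\<in>X. \<Sum>j\<in>X. M t i j)))"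
      by (rule sum.cong[OF refl]) (simp only: eq X)
    also have "\<dots> = 2 * (\<Sum>t\<in>?k f. w t * c t) + 2 * (\<Sum>t\<in>?k f. \<Sum>i\<in>X. w t * b t i)
        + (\<Sum>t\<in>?k f. \<Sum>i\<in>X. \<Sum>j\<in>X. w t * M t i j)"
      by (simp add: distrib_left sum.distrib sum_distrib_left mult_ac)
    also have "(\<Sum>t\<in>?k f. \<Sum>i\<in>X. w t * b t i) = (\<Sum>i\<in>X. \<Sum>t\<in>?k f. w t * b t i)"
      by (rule sum.swap)
    also have "(\<Sum>t\<in>?k f. \<Sum>i\<in>X. \<Sum>j\<in>X. w t * M t i j) = (\<Sum>i\<in>X. \<Sum>t\<in>?k f. \<Sum>j\<in>X. w t * M t i j)"
      by (rule sum.swap)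
    also have "\<dots> = (\<Sum>i\<in>X. \<Sum>j\<in>X. \<Sum>t\<in>?k f. w t * M t i j)"
      by (intro sum.cong refl sum.swap)
    finally show "2 * set_eval f X = 2 * (\<Sum>t\<in>?k f. w t * c t) + 2 * (\<Sum>i\<in>X. \<Sum>t\<in>?k f. w t * b t i)
        + (\<Sum>i\<in>X. \<Sum>j\<in>X. \<Sum>t\<in>?k f. w t * M t i j)" .
  qed simp
  then show ?thesis by blast
qed

section \<open>From the cube average to the final estimate\<close>

lemma cube_average_eq_sum_Pow:
  assumes "\<And>x. x \<in> boolean_cube n \<Longrightarrow> g x = h {i. i < n \<and> x i = 1}"
  shows "cube_average n g = (\<Sum>X\<in>Pow {..<n}. h X) / 2 ^ n"
proof -
  have "(\<Sum>x\<in>boolean_cube n. g x) = (\<Sum>X\<in>Pow {..<n}. h X)"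
  proof (rule sum.reindex_bij_witness[of _ "\<lambda>X. \<lambda>i\<in>{..<n}. of_bool (i \<in> X)" "\<lambda>x. {i. i < n \<and> x i = 1}"])
    fix x assume x: "x \<in> boolean_cube n"
    show "(\<lambda>i\<in>{..<n}. of_bool (i \<in> {i. i < n \<and> x i = 1})) = x"
    proof
      fix i
      show "(\<lambda>i\<in>{..<n}. of_bool (i \<in> {i. i < n \<and> x i = 1})) i = x i"
        using x by (cases "i < n") (auto simp: boolean_cube_def PiE_def extensional_def Pi_def)
    qed
    show "h {i. i < n \<and> x i = 1} = g x" using assms[OF x] by simp
  qed (auto simp: boolean_cube_def)
  moreover have "card (boolean_cube n) = 2 ^ n"
    by (simp add: boolean_cube_def card_PiE numeral_2_eq_2)
  ultimately show ?thesis by (simp add: cube_average_def)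
qed

text \<open>The forms are the coordinates in \<open>A \<union> B\<close>, the rows in
  \<open>A \<union> B \<union> I\<close>, and one more form \<open>l\<close>;
  \<open>card B = card A\<close> gives the count. For odd \<open>q\<close> the set \<open>I\<close>
  is empty, so one statement serves both parities.\<close>

lemma boolean_rank_le_independent_sets:
  assumes cq: "cube_quadratic {..<n} c b M F"
    and f: "\<And>x. x \<in> boolean_cube n \<Longrightarrow> f x = F {i. i < n \<and> x i = 1}"
    and p: "prime p" and q: "q = p ^ a" "a \<ge> 1"
  obtains A I where "A \<subseteq> {..<n}" "indep_mod (int p) (int q) A ({..<n} - A) M"
    "I \<subseteq> {..<n}" "I \<noteq> {} \<Longrightarrow> even q \<and> indep_mod 2 2 I {..<n} M"
    "boolean_rank q n f \<le> 4 * card A + card I + 1"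
    "\<And>u v. A = {} \<Longrightarrow> u < n \<Longrightarrow> v < n \<Longrightarrow> int q dvd M u v"
proof -
  interpret cube_quadratic "{..<n}" c b M F by fact
  let ?V = "{..<n}"
  have ip: "prime (int p)" using p by simp
  have iq: "int q = int p ^ a" using q by simp
  have q1: "q > 1" using one_less_power[OF prime_gt_1_nat[OF p]] q by simp
  obtain A B L where AB: "A \<subseteq> ?V" "B \<subseteq> ?V" "A \<inter> B = {}" "card B = card A"
    and ind: "indep_mod (int p) (int q) A B M"
    and L: "\<forall>u\<in>?V - A - B. \<forall>v\<in>?V - A - B. u \<noteq> v \<longrightarrow> int q dvd M u v - (\<Sum>a\<in>A. L u a * M a v)"
    using off_diagonal_elimination[OF ip iq finite_V, of M] by (elim exE conjE) (rule that)
  have fin: "finite A" "finite B" using AB by (auto intro: finite_subset)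
  have "\<exists>I l. I \<subseteq> ?V \<and> (I \<noteq> {} \<longrightarrow> even q \<and> indep_mod 2 2 I ?V M) \<and>
     (\<forall>X Y. X \<subseteq> ?V \<longrightarrow> Y \<subseteq> ?V \<longrightarrow> agree (int q) (A \<union> B) (A \<union> B \<union> I) X Y \<longrightarrow>
     int q dvd (\<Sum>i\<in>?V. l i * (of_bool (i \<in> X) - of_bool (i \<in> Y))) \<longrightarrow> int q dvd F X - F Y)"
  proof (cases "even q")
    case True
    obtain I where I: "I \<subseteq> ?V" "indep_mod 2 2 I ?V M"
      "\<And>z u. (\<And>i. i \<in> I \<Longrightarrow> even (row z i)) \<Longrightarrow> u \<in> ?V \<Longrightarrow> even (row z u)"
    proof (rule indep_rows_mod_2_exists[OF finite_V, of M, folded row_def])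
      fix I
      assume "I \<subseteq> ?V" "indep_mod 2 2 I ?V M"
        "\<And>z u. (\<And>i. i \<in> I \<Longrightarrow> even (row z i)) \<Longrightarrow> u \<in> ?V \<Longrightarrow> even (row z u)"
      then show thesis by (rule that)
    qed
    have "even (int q)" "int q > 0" using True q1 by auto
    from F_determined_even[OF this AB(1,2) L I(3)] show ?thesis using I(1,2) True by (intro exI[of _ I]) simp
  next
    case False
    then have "odd (int q)" by simp
    from F_determined_odd[OF this AB(1,2) L] show ?thesis by (intro exI[of _ "{}"]) simp
  qed
  then obtain I l where I: "I \<subseteq> ?V" "I \<noteq> {} \<longrightarrow> even q \<and> indep_mod 2 2 I ?V M"
    and det: "\<forall>X Y. X \<subseteq> ?V \<longrightarrow> Y \<subseteq> ?V \<longrightarrow> agree (int q) (A \<union> B) (A \<union> B \<union> I) X Y \<longrightarrow>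
     int q dvd (\<Sum>i\<in>?V. l i * (of_bool (i \<in> X) - of_bool (i \<in> Y))) \<longrightarrow> int q dvd F X - F Y"
    by (elim exE conjE) (rule that)
  have fI: "finite I" using I by (auto intro: finite_subset)
  let ?U = "(\<lambda>a i. of_bool (i = a) :: int) ` (A \<union> B)" and ?R = "M ` (A \<union> B \<union> I)"
  have "boolean_rank q n f \<le> card (insert l (?U \<union> ?R))"
  proof (rule boolean_rank_le_card[OF q1])
    show "finite (insert l (?U \<union> ?R))" using fin fI by simp
    fix x y assume xy: "x \<in> boolean_cube n" "y \<in> boolean_cube n"
      and v: "\<And>v. v \<in> insert l (?U \<union> ?R) \<Longrightarrow> int q dvd (\<Sum>i<n. v i * x i) - (\<Sum>i<n. v i * y i)"
    define X where "X = {i. i < n \<and> x i = 1}"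
    define Y where "Y = {i. i < n \<and> y i = 1}"
    have diff: "(\<Sum>i<n. v i * x i) - (\<Sum>i<n. v i * y i)
        = (\<Sum>i<n. v i * (of_bool (i \<in> X) - of_bool (i \<in> Y)))" for v
    proof -
      have "x i = of_bool (i \<in> X)" "y i = of_bool (i \<in> Y)" if "i < n" for i
        using xy that by (auto simp: X_def Y_def boolean_cube_def PiE_def Pi_def)
      then show ?thesis by (simp add: right_diff_distrib sum_subtractf)
    qed
    \<comment> \<open>Bits that agree modulo \<open>q > 1\<close> are equal, so fixing a coordinate
      form fixes the coordinate itself.\<close>
    have "a \<in> X \<longleftrightarrow> a \<in> Y" if a: "a \<in> A \<union> B" for a
    proof -
      have an: "a < n" using a AB by auto
      have "int q dvd (\<Sum>i<n. of_bool (i = a) * (of_bool (i \<in> X) - of_bool (i \<in> Y)))"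
        using v[of "\<lambda>i. of_bool (i = a)"] a unfolding diff by blast
      also have "(\<Sum>i<n. of_bool (i = a) * (of_bool (i \<in> X) - of_bool (i \<in> Y)))
         = (\<Sum>i<n. if i = a then of_bool (a \<in> X) - of_bool (a \<in> Y) else 0 :: int)"
        by (intro sum.cong) auto
      finally have "int q dvd of_bool (a \<in> X) - of_bool (a \<in> Y)" using an by simp
      then show ?thesis using q1 by (auto simp: of_bool_def split: if_splits)
    qed
    moreover have "int q dvd row (\<lambda>j. of_bool (j \<in> X) - of_bool (j \<in> Y)) i" if "i \<in> A \<union> B \<union> I" for i
      unfolding row_def using v[of "M i"] that unfolding diff by blast
    ultimately have "agree (int q) (A \<union> B) (A \<union> B \<union> I) X Y" by (auto simp: agree_def)
    moreover have "int q dvd (\<Sum>i<n. l i * (of_bool (i \<in> X) - of_bool (i \<in> Y)))"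
      using v[of l] unfolding diff by blast
    ultimately have "int q dvd F X - F Y" by (intro det[rule_format]) (auto simp: X_def Y_def)
    then show "int q dvd f x - f y" using f xy by (simp add: X_def Y_def)
  qed
  also have "card (insert l (?U \<union> ?R)) \<le> Suc (card (?U \<union> ?R))" by (rule card_insert_le_m1) simp_all
  also have "card (?U \<union> ?R) \<le> card ?U + card ?R" by (rule card_Un_le)
  also have "card ?U \<le> card (A \<union> B)" using fin by (intro card_image_le) simp
  also have "card ?R \<le> card (A \<union> B \<union> I)" using fin fI by (intro card_image_le) simp
  also have "card (A \<union> B \<union> I) \<le> card (A \<union> B) + card I" by (rule card_Un_le)
  also have "card (A \<union> B) \<le> card A + card B" by (rule card_Un_le)
  finally have rank: "boolean_rank q n f \<le> 4 * card A + card I + 1" using AB(4) by simp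
  have zero: "int q dvd M u v" if "A = {}" "u < n" "v < n" for u v
  proof -
    have "B = {}" using AB(4) that(1) fin by simp
    then show ?thesis using L that diag[of u] by (cases "u = v") auto
  qed
  have indA: "indep_mod (int p) (int q) A (?V - A) M"
    using ind by (rule indep_mod_mono) (use AB in auto)
  show thesis using that[OF AB(1) indA I(1) I(2)[rule_format] rank zero] .
qed

text \<open>Unless both sets are empty, the larger of \<open>A\<close> and \<open>I\<close> has at
  least a sixth of the rank as its size. It gives decay at rate \<open>\<delta> / 8\<close> with
  \<open>\<delta> = 1/(8 m^2)\<close>, whence \<open>384 = 8 * 8 * 6\<close>.\<close>

lemma bias_le_exp_rank:
  assumes m: "m > 1" and f: "f \<in> poly_ring_Zmod m n" "degree_le f 2"
    and q: "exact_prime_power_divisor q m"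
  shows "cmod (cube_average n (\<lambda>x. e_char m (poly_eval f x)))
     \<le> exp (- real (boolean_rank q n (poly_eval f)) / (384 * real m ^ 2))"
proof -
  obtain p a where p: "prime p" "a \<ge> 1" "q = p ^ a" "q dvd m"
    using q by (auto simp: exact_prime_power_divisor_def)
  have q1: "q > 1" using one_less_power[OF prime_gt_1_nat[OF p(1)]] p by simp
  obtain c b M where cq: "cube_quadratic {..<n} c b M (set_eval f)"
    using set_eval_quadratic[OF f(2)] by metis
  define \<delta> where "\<delta> = 1 / (8 * real m ^ 2)"
  have \<delta>: "0 < \<delta>" "\<delta> \<le> 1"
  proof -
    have "1 \<le> real m ^ 2" using m by simp
    then show "\<delta> \<le> 1" unfolding \<delta>_def by (intro divide_le_eq_1_pos[THEN iffD2]) linarith+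
    show "0 < \<delta>" using m by (simp add: \<delta>_def)
  qed
  interpret cube_quadratic_mod "{..<n}" c b M "set_eval f" m "1 - \<delta>"
  proof -
    interpret cube_quadratic "{..<n}" c b M "set_eval f" by fact
    show "cube_quadratic_mod {..<n} c b M (set_eval f) m (1 - \<delta>)"
      by unfold_locales (use \<delta> norm_one_plus_e_char_le[OF m] in \<open>auto simp: \<delta>_def\<close>)
  qed
  have ev: "poly_eval f x = set_eval f {i. i < n \<and> x i = 1}" if "x \<in> boolean_cube n" for x
    using f(1) that by (intro poly_eval_boolean) (auto simp: poly_ring_Zmod_def)
  let ?R = "boolean_rank q n (poly_eval f)"
  define S where "S = cmod (\<Sum>X\<in>Pow {..<n}. e_char m (set_eval f X))"
  have avg: "cmod (cube_average n (\<lambda>x. e_char m (poly_eval f x))) = S / 2 ^ n"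
    using cube_average_eq_sum_Pow[of n "\<lambda>x. e_char m (poly_eval f x)" "\<lambda>X. e_char m (set_eval f X)"] ev
    by (simp add: S_def norm_divide norm_power)
  obtain A I where AI: "A \<subseteq> {..<n}" "indep_mod (int p) (int q) A ({..<n} - A) M"
    "I \<subseteq> {..<n}" "I \<noteq> {} \<Longrightarrow> even q \<and> indep_mod 2 2 I {..<n} M"
    "?R \<le> 4 * card A + card I + 1"
    "\<And>u v. A = {} \<Longrightarrow> u < n \<Longrightarrow> v < n \<Longrightarrow> int q dvd M u v"
  proof (rule boolean_rank_le_independent_sets[OF cq ev p(1,3,2)])
    fix A I
    assume "A \<subseteq> {..<n}" "indep_mod (int p) (int q) A ({..<n} - A) M"
      "I \<subseteq> {..<n}" "I \<noteq> {} \<Longrightarrow> even q \<and> indep_mod 2 2 I {..<n} M"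
      "?R \<le> 4 * card A + card I + 1"
      "\<And>u v. A = {} \<Longrightarrow> u < n \<Longrightarrow> v < n \<Longrightarrow> int q dvd M u v"
    then show thesis by (rule that)
  qed
  have fin: "finite A" "finite I" using AI by (auto intro: finite_subset)
  have qm: "int q dvd int m" using p(4) by simp
  \<comment> \<open>The bound \<open>1 - \<delta> / 4 \<le> exp (- \<delta> / 4)\<close> is applied
    to the square, so taking the root halves the rate.\<close>
  have sq: "S / 2 ^ n \<le> exp (- (real k * \<delta> / 8))" if "S\<^sup>2 \<le> 4 ^ n * (1 - \<delta> / 4) ^ k" for k
  proof (rule power2_le_imp_le)
    have "(S / 2 ^ n)\<^sup>2 = S\<^sup>2 / 4 ^ n"
      by (simp add: power_divide power2_eq_square flip: power_mult_distrib)
    also have "\<dots> \<le> (1 - \<delta> / 4) ^ k" using that by (simp add: field_simps)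
    also have "\<dots> \<le> exp (- (\<delta> / 4)) ^ k"
      using exp_ge_add_one_self[of "- (\<delta> / 4)"] \<delta> by (intro power_mono) auto
    also have "\<dots> = (exp (- (real k * \<delta> / 8)))\<^sup>2"
      by (simp flip: exp_of_nat_mult exp_double)
    finally show "(S / 2 ^ n)\<^sup>2 \<le> (exp (- (real k * \<delta> / 8)))\<^sup>2" .
  qed simp
  have A_bound: "S / 2 ^ n \<le> exp (- (real (card A) * \<delta> / 8))"
  proof (rule sq)
    have "S\<^sup>2 \<le> 4 ^ n * ((1 + (1 - \<delta>)) / 2) ^ card A"
      using bias_le_off_diagonal[of "int p" "int q" a A] p AI qm by (simp add: S_def)
    also have "\<dots> \<le> 4 ^ n * (1 - \<delta> / 4) ^ card A"
      using \<delta> by (intro mult_left_mono power_mono) auto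
    finally show "S\<^sup>2 \<le> 4 ^ n * (1 - \<delta> / 4) ^ card A" .
  qed
  have "exp (- (real (card A) * \<delta> / 8)) \<le> 1" using \<delta> by simp
  then have le1: "S / 2 ^ n \<le> 1" using A_bound by linarith
  have I_bound: "S / 2 ^ n \<le> exp (- (real (card I) * \<delta> / 8))"
  proof (cases "I = {}")
    case True
    then show ?thesis using le1 by simp
  next
    case False
    then have "even m" using AI(4) p(4) dvd_trans by blast
    show ?thesis
    proof (rule sq)
      \<comment> \<open>This square root is why the common rate is \<open>\<delta> / 4\<close>; the
        bound from \<open>A\<close> alone would give \<open>\<delta> / 2\<close>.\<close>
      have "sqrt (1 - \<delta>) \<le> 1 - \<delta> / 2"
        using \<delta> by (intro real_le_lsqrt) (auto simp: power2_diff)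
      then have le: "(1 + sqrt (1 - \<delta>)) / 2 \<le> 1 - \<delta> / 4" by simp
      have "S\<^sup>2 \<le> 4 ^ n * ((1 + sqrt (1 - \<delta>)) / 2) ^ card I"
        using bias_le_even[OF \<open>even m\<close> AI(3)] AI(4) False by (simp add: S_def)
      also have "\<dots> \<le> 4 ^ n * (1 - \<delta> / 4) ^ card I"
        using \<delta> le by (intro mult_left_mono power_mono) auto
      finally show "S\<^sup>2 \<le> 4 ^ n * (1 - \<delta> / 4) ^ card I" .
    qed
  qed
  have scale: "real ?R / (384 * real m ^ 2) = real ?R * \<delta> / 48" by (simp add: \<delta>_def)
  have "S / 2 ^ n \<le> exp (- (real ?R * \<delta> / 48))"
  proof (cases "A = {} \<and> I = {}")
    case False
    define k where "k = max (card A) (card I)"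
    have "k \<ge> 1" using False fin by (auto simp: k_def Suc_le_eq card_gt_0_iff less_max_iff_disj)
    \<comment> \<open>\<open>4 * k + k + 1 \<le> 6 * k\<close> holds because
      \<open>k \<ge> 1\<close>; the empty case is separate.\<close>
    then have "?R \<le> 6 * k" using AI(5) by (auto simp: k_def)
    then have "real ?R * \<delta> / 48 \<le> real k * \<delta> / 8"
      using \<delta> by (simp add: field_simps flip: of_nat_le_iff[where ?'a = real])
    moreover have "S / 2 ^ n \<le> exp (- (real k * \<delta> / 8))"
      using A_bound I_bound by (simp add: k_def max_def)
    ultimately show ?thesis by (meson exp_le_cancel_iff neg_le_iff_le order_trans)
  next
    case True
    then have R: "?R \<le> 1" using AI(5) by simp
    show ?thesis
    \<comment> \<open>All entries of \<open>M\<close> vanish modulo \<open>q\<close>, so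
      \<open>f\<close> is affine modulo \<open>q\<close>: either a linear coefficient gives
      cancellation, or \<open>f\<close> is constant modulo \<open>q\<close> and the rank is
      0.\<close>
    proof (cases "\<exists>u<n. \<not> int q dvd b u")
      case True
      then obtain u where u: "u < n" "\<not> int q dvd b u" by blast
      have "S \<le> 2 ^ n * (1 - \<delta>)"
        using bias_le_linear[of u "int q"] u qm AI(6) \<open>A = {} \<and> I = {}\<close> by (simp add: S_def)
      then have "S / 2 ^ n \<le> 1 - \<delta>" by (simp add: field_simps)
      also have "\<dots> \<le> exp (- \<delta>)" using exp_ge_add_one_self[of "- \<delta>"] by simp
      also have "\<dots> \<le> exp (- (real ?R * \<delta> / 48))"
        using R \<delta> mult_right_mono[of "real ?R" 1 \<delta>] by simp
      finally show ?thesis .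
    next
      case False
      have "?R \<le> card ({} :: (nat \<Rightarrow> int) set)"
      proof (rule boolean_rank_le_card[OF q1])
        fix x y assume xy: "x \<in> boolean_cube n" "y \<in> boolean_cube n"
        have const: "int q dvd set_eval f X - c" if "X \<subseteq> {..<n}" for X
          using finite_subset[OF that finite_V] that
        proof (induction X rule: finite_induct)
          case empty
          then show ?case using F[of "{}"] by simp
        next
          case (insert u X)
          have "set_eval f ({u} \<union> X) = set_eval f {u} + set_eval f X - c + (\<Sum>j\<in>X. M u j)"
            using F_Un[of "{u}" X] insert by auto
          moreover have "set_eval f {u} = c + b u" using F[of "{u}"] insert.prems diag[of u] by simp
          ultimately have eq: "set_eval f (insert u X) - c = b u + (set_eval f X - c) + (\<Sum>j\<in>X. M u j)" by simp
          have "int q dvd (\<Sum>j\<in>X. M u j)"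
            using insert.prems AI(6) \<open>A = {} \<and> I = {}\<close> by (intro dvd_sum) auto
          moreover have "int q dvd b u" using False insert.prems by auto
          moreover have "int q dvd set_eval f X - c" using insert by simp
          ultimately show ?case unfolding eq by (intro dvd_add)
        qed
        have "int q dvd (poly_eval f x - c) - (poly_eval f y - c)"
          unfolding ev[OF xy(1)] ev[OF xy(2)] by (intro dvd_diff const) auto
        then show "int q dvd poly_eval f x - poly_eval f y" by simp
      qed simp
      then have "?R = 0" by simp
      then show ?thesis using le1 by simp
    qed
  qed
  then show ?thesis by (simp only: avg scale minus_divide_left[symmetric])
qed

theorem theorem4p1:
  "\<exists>C::real. C > 0 \<and>
     (\<forall>(m::nat) (n::nat) (\<epsilon>::real) f.
        m > 1 \<and> 0 < \<epsilon> \<and> \<epsilon> < 1 \<and> f \<in> poly_ring_Zmod m n \<and> degree_le f 2 \<and>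
        (\<exists>q. exact_prime_power_divisor q m \<and>
             real (boolean_rank q n (poly_eval f)) \<ge> C * (real m)\<^sup>2 * ln (1 / \<epsilon>))
        \<longrightarrow> cmod (cube_average n (\<lambda>x. e_char m (poly_eval f x))) < \<epsilon>)"
proof (intro exI[of _ 400] conjI allI impI)
  fix m n \<epsilon> f
  assume "m > 1 \<and> 0 < \<epsilon> \<and> \<epsilon> < 1 \<and> f \<in> poly_ring_Zmod m n \<and> degree_le f 2 \<and>
        (\<exists>q. exact_prime_power_divisor q m \<and>
             real (boolean_rank q n (poly_eval f)) \<ge> 400 * (real m)\<^sup>2 * ln (1 / \<epsilon>))"
  then obtain q where m: "m > 1" and \<epsilon>: "0 < \<epsilon>" "\<epsilon> < 1" and f: "f \<in> poly_ring_Zmod m n" "degree_le f 2"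
    and q: "exact_prime_power_divisor q m"
    and R: "real (boolean_rank q n (poly_eval f)) \<ge> 400 * (real m)\<^sup>2 * ln (1 / \<epsilon>)" by blast
  let ?R = "real (boolean_rank q n (poly_eval f))"
  have "ln (1 / \<epsilon>) > 0" using \<epsilon> by simp
  moreover have "(real m)\<^sup>2 > 0" using m by simp
  \<comment> \<open>Any constant above 384 makes the inequality strict, since the logarithm is
    positive.\<close>
  ultimately have "384 * (real m)\<^sup>2 * ln (1 / \<epsilon>) < 400 * (real m)\<^sup>2 * ln (1 / \<epsilon>)" by simp
  then have "ln (1 / \<epsilon>) * (384 * real m ^ 2) < ?R" using R by (simp add: mult_ac)
  then have "ln (1 / \<epsilon>) < ?R / (384 * real m ^ 2)" using m by (simp add: less_divide_eq)
  then have "exp (- ?R / (384 * real m ^ 2)) < exp (- ln (1 / \<epsilon>))" by simp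
  also have "\<dots> = \<epsilon>" using \<epsilon> by (simp add: ln_div)
  finally show "cmod (cube_average n (\<lambda>x. e_char m (poly_eval f x))) < \<epsilon>"
    using bias_le_exp_rank[OF m f q] by simp
qed simp

end
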